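(* For any constant $\kappa>0$, let $q=q(n)$ satisfy $0<q\le 1-\kappa\cdot\frac{(\log\log n)^2}{\log n}$. Then there exist constants $c_1,c_2>0$ (independent of $n$) such that with high probability \[c_1\left(\sqrt{\frac{\log n}{\log(1/q)}}+1\right)\le \mathrm{tw}(\mathcal{P}(n,q))\le \mathrm{cw}(\mathcal{P}(n,q))\le c_2\left(\sqrt{\frac{\log n}{\log(1/q)}}+1\right).\] Furthermore, if $q=q(n)$ satisfies $1-\frac{(\log\log n)^2}{\log n}\le q\le 1$, then with high probability \[10^{-5}\cdot\min\left\{\frac{1}{1-q},\,n\right\}\le \mathrm{tw}(\mathcal{P}(n,q))\le \mathrm{cw}(\mathcal{P}(n,q))\le 5\cdot\min\left\{\frac{1}{1-q}\cdot\log\left(\frac{1}{1-q}\right),\,n\right\}.\]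
   Context: Let $[n]=\{1,\dots,n\}$ and let $S_n$ be the set of permutations of $[n]$. For $\sigma\in S_n$, $\mathrm{Inv}(\sigma)=|\{(i,j): i<j,\ \sigma(i)>\sigma(j)\}|$. For $0<q\le 1$ the $(n,q)$-Mallows measure on $S_n$ is $\mu_{n,q}(\sigma)=q^{\mathrm{Inv}(\sigma)}/Z_{n,q}$, where $Z_{n,q}=\prod_{i=1}^n(1+q+\cdots+q^{i-1})$ (so $\mu_{n,1}$ is uniform). The tangled path $\mathcal{P}(n,q)$ is the random graph with vertex set $[n]$ and edge set $\{i(i+1):1\le i<n\}\cup\{\sigma(i)\sigma(i+1):1\le i<n\}$, where $\sigma\sim\mu_{n,q}$ (multi-edges are identified). $\mathrm{tw}(G)$ is the treewidth of $G$: the minimum over all tree decompositions of (maximum bag size) $-1$. The cutwidth is \[\mathrm{cw}(G)=\min_{f:V(G)\to\mathbb{Z}\text{ injective}}\ \max_{x\in\mathbb{R}}\ |\{ij\in E(G): f(i)\le x<f(j)\}|.\] A sequence of events $\mathcal{E}_n$ holds with high probability if $\mathbb{P}(\mathcal{E}_n)\to 1$ as $n\to\infty$. $\log$ is the natural logarithm. When $q=1$, $1/(1-q)$ and $\frac{1}{1-q}\log\frac{1}{1-q}$ are read as $+\infty$ (so that both minima equal $n$). *)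

theory Defs
  imports "HOL-Probability.Probability" "HOL-Combinatorics.Permutations"
begin

text \<open>A graph is a pair of a vertex set and a set of edges, an edge being the two-element
  set of its endpoints.\<close>

type_synonym 'a graph = "'a set \<times> 'a set set"

abbreviation verts :: "'a graph \<Rightarrow> 'a set" where "verts G \<equiv> fst G"

abbreviation edges :: "'a graph \<Rightarrow> 'a set set" where "edges G \<equiv> snd G"

definition simple_graph :: "'a graph \<Rightarrow> bool" where
  "simple_graph G \<longleftrightarrow> finite (verts G) \<and> (\<forall>e\<in>edges G. e \<subseteq> verts G \<and> card e = 2)"

text \<open>The subgraph induced by \<open>S\<close> is connected, where the empty subgraph counts as connected.\<close>

definition connected_in :: "'a graph \<Rightarrow> 'a set \<Rightarrow> bool" where
  "connected_in G S \<longleftrightarrow>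
     (\<forall>u\<in>S. \<forall>v\<in>S. (u, v) \<in> {(x, y). x \<in> S \<and> y \<in> S \<and> {x, y} \<in> edges G}\<^sup>*)"

definition graph_cycle :: "'a graph \<Rightarrow> 'a list \<Rightarrow> bool" where
  "graph_cycle G vs \<longleftrightarrow> length vs \<ge> 3 \<and> distinct vs \<and>
     (\<forall>i<length vs. {vs ! i, vs ! (Suc i mod length vs)} \<in> edges G)"

definition tree_graph :: "'a graph \<Rightarrow> bool" where
  "tree_graph T \<longleftrightarrow> simple_graph T \<and> verts T \<noteq> {} \<and> connected_in T (verts T) \<and>
     (\<nexists>vs. graph_cycle T vs)"

definition tree_decomposition :: "'a graph \<Rightarrow> 'b graph \<Rightarrow> ('b \<Rightarrow> 'a set) \<Rightarrow> bool" where
  "tree_decomposition G T B \<longleftrightarrow> tree_graph T \<and>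
     (\<Union>t\<in>verts T. B t) = verts G \<and>
     (\<forall>e\<in>edges G. \<exists>t\<in>verts T. e \<subseteq> B t) \<and>
     (\<forall>v\<in>verts G. connected_in T {t \<in> verts T. v \<in> B t})"

definition decomposition_width :: "'b graph \<Rightarrow> ('b \<Rightarrow> 'a set) \<Rightarrow> nat" where
  "decomposition_width T B = Max ((\<lambda>t. card (B t)) ` verts T) - 1"

text \<open>The tree of a decomposition is finite, so taking its nodes to be natural numbers is no
  restriction. The truncated subtraction in the width only affects graphs without vertices.\<close>

definition treewidth :: "'a graph \<Rightarrow> nat" where
  "treewidth G = (LEAST k. \<exists>(T :: nat graph) B.
     tree_decomposition G T B \<and> decomposition_width T B = k)"

definition cut_size :: "'a graph \<Rightarrow> ('a \<Rightarrow> int) \<Rightarrow> real \<Rightarrow> nat" where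
  "cut_size G f x =
     card {e \<in> edges G. \<exists>i j. e = {i, j} \<and> real_of_int (f i) \<le> x \<and> x < real_of_int (f j)}"

definition cutwidth :: "'a graph \<Rightarrow> nat" where
  "cutwidth G = (LEAST k. \<exists>f. inj_on f (verts G) \<and> Max (range (cut_size G f)) = k)"

text \<open>Permutations of $[n]$ are functions on \<open>nat\<close> fixing everything outside \<open>{1..n}\<close>.\<close>

definition inversion_number :: "nat \<Rightarrow> (nat \<Rightarrow> nat) \<Rightarrow> nat" where
  "inversion_number n \<sigma> = card {(i, j). i \<in> {1..n} \<and> j \<in> {1..n} \<and> i < j \<and> \<sigma> i > \<sigma> j}"

definition mallows_Z :: "nat \<Rightarrow> real \<Rightarrow> real" where
  "mallows_Z n q = (\<Prod>i=1..n. \<Sum>k<i. q ^ k)"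

definition mallows :: "nat \<Rightarrow> real \<Rightarrow> (nat \<Rightarrow> nat) measure" where
  "mallows n q = point_measure {\<sigma>. \<sigma> permutes {1..n}}
     (\<lambda>\<sigma>. ennreal (q ^ inversion_number n \<sigma> / mallows_Z n q))"

text \<open>The random graph $\mathcal{P}(n,q)$ is \<open>tangled_path n \<sigma>\<close> with \<open>\<sigma>\<close> drawn from \<open>mallows n q\<close>.\<close>

definition tangled_path :: "nat \<Rightarrow> (nat \<Rightarrow> nat) \<Rightarrow> nat graph" where
  "tangled_path n \<sigma> =
     ({1..n}, {{i, i + 1} |i. 1 \<le> i \<and> i < n} \<union> {{\<sigma> i, \<sigma> (i + 1)} |i. 1 \<le> i \<and> i < n})"

definition whp :: "(nat \<Rightarrow> 'a measure) \<Rightarrow> (nat \<Rightarrow> 'a \<Rightarrow> bool) \<Rightarrow> bool" where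
  "whp M E \<longleftrightarrow> (\<lambda>n. \<P>(x in M n. E n x)) \<longlonglongrightarrow> 1"

end

theory Submission
  imports Defs "HOL-Real_Asymp.Real_Asymp"
begin

text \<open>A Mallows permutation can be grown by appending a last value. If \<open>e\<close> of the earlier values lie
  above the appended one, the number of inversions grows by \<open>e\<close>; so \<open>e\<close> is independent of the
  relative order so far and has a truncated geometric distribution with ratio \<open>q\<close>
  (\<open>mallows_mean_Suc\<close>). Both bounds rest on this recursion.

  For the upper bound, order the vertices by their names. The number of edges that cross between \<open>x\<close> and
  \<open>x + 1\<close> is at most \<open>4 * D + 2\<close>, where \<open>D\<close> is the number of positions after \<open>x\<close> with a value at most \<open>x\<close>
  (\<open>cut_size_tangled_path\<close>). Strip off the last positions one at a time and let \<open>r\<close> be the number of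
  remaining values above \<open>x\<close>. Each step removes a value above \<open>x\<close>, or else, with probability at most
  \<open>q ^ r\<close>, one of those at most \<open>x\<close>, in which case \<open>r\<close> stays. The last \<open>r\<close> equals \<open>D\<close>, which is also the
  number of times that \<open>r\<close> stayed. Hence \<open>d \<le> D\<close> requires \<open>d\<close> stays at levels at least \<open>d\<close>, which has
  probability at most \<open>q ^ (d * (d - 1))\<close> times an Euler product that is only exponential in
  \<open>1 / (1 - q)\<close> (\<open>mallows_late_low_tail\<close>). After a union bound over \<open>x\<close> it suffices to take for \<open>d\<close> a multiple
  of \<open>sqrt (ln n / ln (1 / q)) + 1\<close>, and \<open>5 / 4 * h * ln h\<close> with \<open>h = 1 / (1 - q)\<close> when \<open>q\<close> is close to 1; the ranges of
  the two statements are such that \<open>4 / (1 - q)\<close> is then negligible in the exponent.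

  For the lower bound, take a block of \<open>m\<close> consecutive positions. A tree decomposition of small width has
  a bag that leaves a fair share of the values of the block on either side
  (\<open>tree_decomposition_separation\<close>). Contracting the path \<open>1, ..., n\<close> onto these values shows that the
  relative order \<open>\<rho>\<close> of the block has a small set \<open>S\<close> which cuts the path \<open>1, ..., m\<close> and the path
  \<open>\<rho> 1, ..., \<rho> m\<close> in the same way (\<open>separated_block_of_treewidth_less\<close>). This is rare: there are few ways
  to cut a path by a small set, whereas a uniform \<open>\<rho>\<close> takes one large set to another only with
  exponentially small probability (\<open>card_separated\<close>). All but a fraction of order \<open>exp (- m / 12)\<close> of the
  permutations of length \<open>m\<close> therefore force treewidth at least \<open>m div 1000\<close>.

  If \<open>q\<close> is close to 1, let \<open>m\<close> be about a fortieth of \<open>min h n\<close>. On permutations of this length the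
  Mallows measure exceeds the uniform one by a factor of at most \<open>exp (m / 20)\<close>, which the fraction above
  absorbs, so that already the first block is good (\<open>mallows_treewidth_first_block\<close>). For smaller \<open>q\<close> fix
  one good pattern of length \<open>m = b * sqrt (ln n / ln (1 / q))\<close>. Whatever happened before, a block has this
  pattern with probability at least \<open>n powr (- 1 / 2)\<close>, and there are about \<open>n / m\<close> disjoint blocks
  (\<open>mallows_treewidth_some_block\<close>).\<close>

section \<open>Small separators from tree decompositions\<close>

abbreviation adj_within :: "'a graph \<Rightarrow> 'a set \<Rightarrow> ('a \<times> 'a) set" where
  "adj_within G S \<equiv> {(x, y). x \<in> S \<and> y \<in> S \<and> {x, y} \<in> edges G}"

lemma sym_adj_within: "sym (adj_within G S)"
  by (auto simp: sym_def insert_commute)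

lemma connected_in_sym:
  "(u, v) \<in> (adj_within G S)\<^sup>* \<Longrightarrow> (v, u) \<in> (adj_within G S)\<^sup>*"
  by (rule symD[OF sym_rtrancl[OF sym_adj_within]])

lemma connected_in_insert:
  assumes "connected_in G C" "c \<in> C" "{c, t} \<in> edges G"
  shows "connected_in G (insert t C)"
proof -
  let ?R = "adj_within G (insert t C)"
  have mono: "(adj_within G C)\<^sup>* \<subseteq> ?R\<^sup>*" by (rule rtrancl_mono) auto
  have to_c: "(u, c) \<in> ?R\<^sup>*" if "u \<in> insert t C" for u
  proof (cases "u \<in> C")
    case True
    then show ?thesis using assms mono unfolding connected_in_def by blast
  next
    case False
    then have "u = t" using that by auto
    then have "(u, c) \<in> ?R" using assms by (auto simp: insert_commute)
    then show ?thesis by blast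
  qed
  show ?thesis unfolding connected_in_def
  proof (intro ballI)
    fix u v assume "u \<in> insert t C" "v \<in> insert t C"
    then show "(u, v) \<in> ?R\<^sup>*" using rtrancl_trans[OF to_c connected_in_sym[OF to_c]] by blast
  qed
qed

lemma connected_in_crossing_edge:
  assumes "connected_in G S" "C \<subset> S" "C \<noteq> {}"
  obtains c t where "c \<in> C" "t \<in> S - C" "{c, t} \<in> edges G"
proof -
  obtain a b where ab: "a \<in> C" "b \<in> S - C" using assms by auto
  then have "(a, b) \<in> (adj_within G S)\<^sup>*" using assms unfolding connected_in_def by auto
  then have "b \<notin> C \<longrightarrow> (\<exists>c\<in>C. \<exists>t\<in>S - C. {c, t} \<in> edges G)"
  proof (induction rule: rtrancl_induct)
    case base then show ?case using ab by auto
  next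
    case (step y z) then show ?case by auto
  qed
  then show ?thesis using ab that by auto
qed

text \<open>A maximal proper connected subset misses only one vertex, since an edge leaving it can be used to
  enlarge it.\<close>

lemma connected_in_remove_vertex:
  assumes "connected_in G S" "finite S" "card S \<ge> 2"
  obtains t where "t \<in> S" "connected_in G (S - {t})"
proof -
  let ?F = "{C. C \<subset> S \<and> C \<noteq> {} \<and> connected_in G C}"
  have fin: "finite ?F" by (rule finite_subset[of _ "Pow S"]) (use assms in auto)
  obtain x where "x \<in> S" using assms by fastforce
  then have "{x} \<in> ?F" using assms(3) by (auto simp: connected_in_def)
  then obtain C where C: "C \<in> ?F" and max: "\<And>D. D \<in> ?F \<Longrightarrow> C \<subseteq> D \<Longrightarrow> C = D"
    using finite_has_maximal[OF fin] by auto
  obtain c t where ct: "c \<in> C" "t \<in> S - C" "{c, t} \<in> edges G"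
    using connected_in_crossing_edge[OF assms(1)] C by auto
  have "connected_in G (insert t C)" using connected_in_insert[OF _ ct(1,3)] C by blast
  moreover have "insert t C \<noteq> C" using ct by auto
  ultimately have "insert t C \<notin> ?F" using max by blast
  then have "S = insert t C" using C ct \<open>connected_in G (insert t C)\<close> by auto
  then have "S - {t} = C" using ct by auto
  then show ?thesis using that ct C by auto
qed

lemma rtrancl_adj_within_simple_path:
  assumes "(u, v) \<in> (adj_within G S)\<^sup>*" "u \<in> S"
  shows "\<exists>vs. vs \<noteq> [] \<and> hd vs = u \<and> last vs = v \<and> distinct vs \<and> set vs \<subseteq> S \<and>
     successively (\<lambda>a b. {a, b} \<in> edges G) vs"
  using assms(1)
proof (induction rule: rtrancl_induct)
  case base
  show ?case by (rule exI[of _ "[u]"]) (use assms(2) in auto)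
next
  case (step y z)
  then obtain vs where vs: "vs \<noteq> []" "hd vs = u" "last vs = y" "distinct vs" "set vs \<subseteq> S"
     "successively (\<lambda>a b. {a, b} \<in> edges G) vs" by blast
  show ?case
  proof (cases "z \<in> set vs")
    case True
    then obtain xs ys where "vs = xs @ z # ys" by (meson split_list)
    then show ?thesis using vs
      by (intro exI[of _ "xs @ [z]"]) (auto simp: successively_append_iff hd_append split: if_splits)
  next
    case False
    then show ?thesis using vs step
      by (intro exI[of _ "vs @ [z]"]) (auto simp: successively_append_iff)
  qed
qed

text \<open>Take a vertex \<open>t\<close> whose removal leaves the tree connected. Two neighbours of \<open>t\<close> would be joined
  by a path avoiding \<open>t\<close>, and \<open>t\<close> would close it to a cycle.\<close>

lemma tree_graph_leaf:
  assumes T: "tree_graph T" and "card (verts T) \<ge> 2"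
  obtains t p where "t \<in> verts T" "p \<in> verts T" "p \<noteq> t" "{t, p} \<in> edges T"
    "\<And>u. {t, u} \<in> edges T \<Longrightarrow> u = p" "connected_in T (verts T - {t})"
proof -
  have simple: "finite (verts T)" "\<And>e. e \<in> edges T \<Longrightarrow> e \<subseteq> verts T \<and> card e = 2"
    and con: "connected_in T (verts T)" and nocyc: "\<nexists>vs. graph_cycle T vs"
    using T unfolding tree_graph_def simple_graph_def by auto
  obtain t where t: "t \<in> verts T" "connected_in T (verts T - {t})"
    using connected_in_remove_vertex[OF con simple(1) assms(2)] by auto
  have "verts T - {t} \<noteq> {}"
  proof
    assume "verts T - {t} = {}"
    then have "verts T = {t}" using t by auto
    then show False using assms(2) by simp
  qed
  then obtain p where p: "p \<in> verts T - {t}" "{p, t} \<in> edges T"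
    using connected_in_crossing_edge[OF con, of "verts T - {t}"] t by blast
  have uniq: "u = p" if u: "{t, u} \<in> edges T" for u
  proof (rule ccontr)
    assume "u \<noteq> p"
    have uV: "u \<in> verts T - {t}" using simple(2)[OF u] by (auto simp: card_insert_if split: if_splits)
    then have "(u, p) \<in> (adj_within T (verts T - {t}))\<^sup>*"
      using t(2) p unfolding connected_in_def by auto
    then obtain vs where vs: "vs \<noteq> []" "hd vs = u" "last vs = p" "distinct vs"
      "set vs \<subseteq> verts T - {t}" "successively (\<lambda>a b. {a, b} \<in> edges T) vs"
      using rtrancl_adj_within_simple_path[OF _ uV] by blast
    have len: "length vs \<ge> 2"
      using vs(1-3) \<open>u \<noteq> p\<close> by (cases vs; cases "tl vs") auto
    have suc: "successively (\<lambda>a b. {a, b} \<in> edges T) (vs @ [t])"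
      using vs p by (auto simp: successively_append_iff)
    have "graph_cycle T (vs @ [t])"
      unfolding graph_cycle_def
    proof (intro conjI allI impI)
      fix i assume i: "i < length (vs @ [t])"
      show "{(vs @ [t]) ! i, (vs @ [t]) ! (Suc i mod length (vs @ [t]))} \<in> edges T"
      proof (cases "Suc i < length (vs @ [t])")
        case True
        then have "Suc i mod length (vs @ [t]) = Suc i" by simp
        then show ?thesis using suc[unfolded successively_conv_nth, rule_format, OF True] by (simp only:)
      next
        case False
        then have "i = length vs" using i by auto
        then show ?thesis using u vs(1,2) by (simp add: nth_append hd_conv_nth)
      qed
    qed (use len vs in auto)
    then show False using nocyc by blast
  qed
  have "{t, p} \<in> edges T" using p(2) by (simp add: insert_commute)
  then show ?thesis using t p(1) uniq by (intro that[of t p]) blast+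
qed

definition remove_vertex :: "'a graph \<Rightarrow> 'a \<Rightarrow> 'a graph" where
  "remove_vertex T t = (verts T - {t}, {e \<in> edges T. t \<notin> e})"

lemma connected_in_remove_vertex_iff:
  "t \<notin> X \<Longrightarrow> connected_in (remove_vertex T t) X = connected_in T X"
proof -
  assume "t \<notin> X"
  then have "adj_within (remove_vertex T t) X = adj_within T X"
    by (auto simp: remove_vertex_def)
  then show ?thesis unfolding connected_in_def by simp
qed

lemma tree_graph_remove_vertex:
  assumes "tree_graph T" "connected_in T (verts T - {t})" "verts T - {t} \<noteq> {}"
  shows "tree_graph (remove_vertex T t)"
proof -
  have "connected_in (remove_vertex T t) (verts T - {t})"
    by (subst connected_in_remove_vertex_iff) (use assms in auto)
  moreover have "graph_cycle T vs" if "graph_cycle (remove_vertex T t) vs" for vs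
    using that unfolding graph_cycle_def remove_vertex_def by auto
  moreover have "simple_graph (remove_vertex T t)"
    using assms(1) unfolding tree_graph_def simple_graph_def remove_vertex_def by auto
  moreover have "verts (remove_vertex T t) = verts T - {t}" by (simp add: remove_vertex_def)
  ultimately show ?thesis using assms unfolding tree_graph_def by auto
qed

text \<open>A walk through a leaf enters and leaves it by the same neighbour, so the detour can be cut out.\<close>

lemma connected_in_remove_leaf:
  assumes con: "connected_in T X" and leaf: "\<And>u. {t, u} \<in> edges T \<Longrightarrow> u = p" and "p \<noteq> t"
  shows "connected_in T (X - {t})"
  unfolding connected_in_def
proof (intro ballI)
  fix u v assume u: "u \<in> X - {t}" and v: "v \<in> X - {t}"
  let ?R = "adj_within T (X - {t})"
  have "(u, v) \<in> (adj_within T X)\<^sup>*" using con u v unfolding connected_in_def by auto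
  then have "(v \<noteq> t \<longrightarrow> (u, v) \<in> ?R\<^sup>*) \<and> (v = t \<longrightarrow> (u, p) \<in> ?R\<^sup>*)"
  proof (induction rule: rtrancl_induct)
    case base then show ?case using u by auto
  next
    case (step y z)
    consider "y = t" | "z = t" "y \<noteq> t" | "y \<noteq> t" "z \<noteq> t" by auto
    then show ?case
    proof cases
      case 1
      then have "z = p" using step leaf by auto
      then show ?thesis using 1 step \<open>p \<noteq> t\<close> by auto
    next
      case 2
      then have "y = p" using step leaf[of y] by (auto simp: insert_commute)
      then show ?thesis using 2 step by auto
    next
      case 3
      then have "(y, z) \<in> ?R" using step by auto
      then show ?thesis using 3 step by (meson rtrancl.rtrancl_into_rtrancl)
    qed
  qed
  then show "(u, v) \<in> ?R\<^sup>*" using v by auto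
qed

text \<open>The leaves of the tree are removed one after the other, and the load \<open>L t\<close> collects the vertices
  that occur only in removed bags, from branches at \<open>t\<close>. Removing a leaf adds to its neighbour \<open>p\<close> a load of
  less than \<open>\<tau> + k\<close>, so the first load to reach \<open>\<tau>\<close> is at most \<open>2 * \<tau> + k\<close>, and the bag of \<open>p\<close> separates
  it from everything else. If no load ever reached \<open>\<tau>\<close>, the last bag would have to hold
  the rest of \<open>W\<close>.\<close>

lemma loaded_tree_separation:
  fixes T :: "'b graph" and B L :: "'b \<Rightarrow> 'a set" and V W :: "'a set" and E :: "'a set set"
  assumes "tree_graph T"
    and "\<And>t. t \<in> verts T \<Longrightarrow> finite (B t) \<and> card (B t) \<le> k"
    and "finite W" "W \<subseteq> V" "\<tau> + k \<le> card W"
    and "V = (\<Union>t\<in>verts T. L t \<union> B t)"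
    and "\<And>t. t \<in> verts T \<Longrightarrow> card (L t \<inter> W) < \<tau>"
    and "\<And>t s. t \<in> verts T \<Longrightarrow> s \<in> verts T \<Longrightarrow> L t \<inter> B s = {}"
    and "\<And>u v. {u, v} \<in> E \<Longrightarrow> \<exists>t\<in>verts T. u \<in> L t \<union> B t \<and> v \<in> L t \<union> B t"
    and "\<And>u v t. {u, v} \<in> E \<Longrightarrow> t \<in> verts T \<Longrightarrow> u \<in> L t \<Longrightarrow> v \<in> L t \<union> B t"
    and "\<And>v. connected_in T {t \<in> verts T. v \<in> B t}"
  shows "\<exists>A S. A \<subseteq> V \<and> S \<subseteq> V \<and> A \<inter> S = {} \<and> card S \<le> k \<and> \<tau> \<le> card (A \<inter> W) \<and>
     card (A \<inter> W) \<le> 2 * \<tau> + k \<and> (\<forall>u v. {u, v} \<in> E \<longrightarrow> u \<in> A \<longrightarrow> v \<in> A \<union> S)"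
  using assms
proof (induction "card (verts T)" arbitrary: T L rule: less_induct)
  case less
  note tree = less.prems(1) and bag = less.prems(2) and W = less.prems(3-5) and V = less.prems(6)
    and light = less.prems(7) and disj = less.prems(8) and cover = less.prems(9)
    and closed = less.prems(10) and con = less.prems(11)
  have finT: "finite (verts T)" "verts T \<noteq> {}"
    using tree unfolding tree_graph_def simple_graph_def by auto
  show ?case
  proof (cases "card (verts T) \<ge> 2")
    case False
    then have "card (verts T) = 1" using finT by (metis One_nat_def Suc_leI card_gt_0_iff le_antisym not_less_eq_eq numeral_2_eq_2)
    then obtain t where t: "verts T = {t}" by (auto simp: card_1_singleton_iff)
    have "W \<subseteq> (L t \<inter> W) \<union> B t" using V W t by auto
    then have "card W \<le> card ((L t \<inter> W) \<union> B t)" by (rule card_mono[rotated]) (use W bag t in auto)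
    also have "\<dots> \<le> card (L t \<inter> W) + card (B t)" by (rule card_Un_le)
    also have "\<dots> < \<tau> + k" using light[of t] bag[of t] t by auto
    finally show ?thesis using W by simp
  next
    case True
    obtain t p where t: "t \<in> verts T" and p: "p \<in> verts T" and pt: "p \<noteq> t"
      and tp: "{t, p} \<in> edges T" and leaf: "\<And>u. {t, u} \<in> edges T \<Longrightarrow> u = p"
      and con': "connected_in T (verts T - {t})"
      using tree_graph_leaf[OF tree True] by metis
    define P where "P = L p \<union> L t \<union> (B t - B p)"
    define T' where "T' = remove_vertex T t"
    define L' where "L' = L(p := P)"
    have VT': "verts T' = verts T - {t}" by (simp add: T'_def remove_vertex_def)
    \<comment> \<open>The bags that contain \<open>v\<close> are connected, so they can be left from the leaf only through \<open>p\<close>.\<close>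
    have own: "v \<notin> B s" if v: "v \<in> B t - B p" and s: "s \<in> verts T - {t}" for v s
    proof
      assume "v \<in> B s"
      let ?X = "{t \<in> verts T. v \<in> B t}"
      have tX: "{t} \<subset> ?X" using v s t \<open>v \<in> B s\<close> by auto
      obtain c u where "c \<in> {t}" "u \<in> ?X - {t}" "{c, u} \<in> edges T"
        using connected_in_crossing_edge[OF con tX] by auto
      then have "u = p" using leaf by auto
      then show False using \<open>u \<in> ?X - {t}\<close> v by auto
    qed
    have Pdisj: "P \<inter> B s = {}" if "s \<in> verts T - {t}" for s
      using own[OF _ that] disj[OF p, of s] disj[OF t, of s] that unfolding P_def by auto
    have Pclosed: "v \<in> P \<union> B p" if uv: "{u, v} \<in> E" and u: "u \<in> P" for u v
    proof -
      consider "u \<in> L p" | "u \<in> L t" | "u \<in> B t - B p" using u unfolding P_def by auto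
      then show ?thesis
      proof cases
        case 1 then show ?thesis using closed[OF uv p] unfolding P_def by auto
      next
        case 2 then show ?thesis using closed[OF uv t] unfolding P_def by auto
      next
        case 3
        obtain s where s: "s \<in> verts T" "u \<in> L s \<union> B s" "v \<in> L s \<union> B s" using cover[OF uv] by auto
        then have "u \<in> B s" using disj[OF s(1) t] 3 by auto
        then have "s = t" using own[OF 3, of s] s by auto
        then show ?thesis using s unfolding P_def by auto
      qed
    qed
    have PV: "P \<subseteq> V" unfolding P_def V using t p by auto
    have "P \<inter> W \<subseteq> (L p \<inter> W) \<union> (L t \<inter> W) \<union> B t" unfolding P_def by auto
    then have "card (P \<inter> W) \<le> card ((L p \<inter> W) \<union> (L t \<inter> W) \<union> B t)"
      by (rule card_mono[rotated]) (use W bag t in auto)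
    also have "\<dots> \<le> card (L p \<inter> W) + card (L t \<inter> W) + card (B t)"
      by (meson add_le_mono1 card_Un_le order_trans)
    also have "\<dots> \<le> 2 * \<tau> + k" using light[OF p] light[OF t] bag[OF t] by auto
    finally have Pcard: "card (P \<inter> W) \<le> 2 * \<tau> + k" .
    show ?thesis
    proof (cases "\<tau> \<le> card (P \<inter> W)")
      case True
      show ?thesis
        by (rule exI[of _ P], rule exI[of _ "B p"])
          (use True Pcard PV Pdisj p pt bag Pclosed V in auto)
    next
      case False
      show ?thesis
      proof (rule less.hyps[of T' L'])
        show "card (verts T') < card (verts T)" using VT' finT t by (simp add: card_gt_0_iff)
        show "tree_graph T'" unfolding T'_def
          by (rule tree_graph_remove_vertex[OF tree con']) (use p pt in auto)
        show "V = (\<Union>s\<in>verts T'. L' s \<union> B s)"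
        proof -
          define Q where "Q = verts T - {t} - {p}"
          have Q: "verts T' = insert p Q" "verts T = insert t (insert p Q)" "p \<notin> Q"
            using VT' t p pt by (auto simp: Q_def)
          have "(\<Union>s\<in>Q. L' s \<union> B s) = (\<Union>s\<in>Q. L s \<union> B s)"
            by (rule SUP_cong) (use Q in \<open>auto simp: L'_def\<close>)
          then have "(\<Union>s\<in>verts T'. L' s \<union> B s) = (P \<union> B p) \<union> (\<Union>s\<in>Q. L s \<union> B s)"
            unfolding Q(1) UN_insert by (simp add: L'_def)
          also have "\<dots> = (L t \<union> B t) \<union> ((L p \<union> B p) \<union> (\<Union>s\<in>Q. L s \<union> B s))"
            unfolding P_def by blast
          finally show ?thesis unfolding V Q(2) UN_insert by simp
        qed
        show "\<exists>s\<in>verts T'. u \<in> L' s \<union> B s \<and> v \<in> L' s \<union> B s" if uv: "{u, v} \<in> E" for u v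
        proof -
          obtain s where s: "s \<in> verts T" "u \<in> L s \<union> B s" "v \<in> L s \<union> B s" using cover[OF uv] by auto
          show ?thesis
          proof (cases "s = t \<or> s = p")
            case True
            then have "u \<in> L' p \<union> B p \<and> v \<in> L' p \<union> B p" using s by (auto simp: L'_def P_def)
            then show ?thesis using p pt VT' by auto
          next
            case False then show ?thesis using s VT' by (intro bexI[of _ s]) (auto simp: L'_def)
          qed
        qed
        show "v \<in> L' s \<union> B s" if "{u, v} \<in> E" "s \<in> verts T'" "u \<in> L' s" for u v s
        proof (cases "s = p")
          case True
          then show ?thesis using Pclosed[OF that(1)] that(3) by (simp add: L'_def)
        next
          case False
          then show ?thesis using closed[OF that(1), of s] that(2,3) VT' by (simp add: L'_def)
        qed
        show "L' s \<inter> B r = {}" if "s \<in> verts T'" "r \<in> verts T'" for s r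
          using that disj[of s r] Pdisj[of r] VT' by (auto simp: L'_def)
        show "connected_in T' {s \<in> verts T'. v \<in> B s}" for v
        proof -
          have "connected_in T ({s \<in> verts T. v \<in> B s} - {t})"
            by (rule connected_in_remove_leaf[OF con leaf pt])
          moreover have "{s \<in> verts T'. v \<in> B s} = {s \<in> verts T. v \<in> B s} - {t}" using VT' by auto
          ultimately show ?thesis unfolding T'_def by (simp add: connected_in_remove_vertex_iff)
        qed
        show "card (L' s \<inter> W) < \<tau>" if "s \<in> verts T'" for s
          using that False light[of s] VT' by (auto simp: L'_def)
      qed (use W bag VT' in auto)
    qed
  qed
qed

lemma tree_decomposition_separation:
  fixes G :: "'a graph" and T :: "'b graph"
  assumes dec: "tree_decomposition G T B" and "simple_graph G"
    and bag: "\<And>t. t \<in> verts T \<Longrightarrow> card (B t) \<le> k"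
    and W: "W \<subseteq> verts G" "\<tau> + k \<le> card W" "\<tau> > 0"
  obtains A S where "A \<subseteq> verts G" "S \<subseteq> verts G" "A \<inter> S = {}" "card S \<le> k"
    "\<tau> \<le> card (A \<inter> W)" "card (A \<inter> W) \<le> 2 * \<tau> + k"
    "\<And>u v. {u, v} \<in> edges G \<Longrightarrow> u \<in> A \<Longrightarrow> v \<in> A \<union> S"
proof -
  have fin: "finite (verts G)" using assms unfolding simple_graph_def by auto
  have un: "(\<Union>t\<in>verts T. B t) = verts G" using dec unfolding tree_decomposition_def by auto
  have "\<exists>A S. A \<subseteq> verts G \<and> S \<subseteq> verts G \<and> A \<inter> S = {} \<and> card S \<le> k \<and> \<tau> \<le> card (A \<inter> W) \<and>
     card (A \<inter> W) \<le> 2 * \<tau> + k \<and> (\<forall>u v. {u, v} \<in> edges G \<longrightarrow> u \<in> A \<longrightarrow> v \<in> A \<union> S)"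
  proof (rule loaded_tree_separation[where T = T and L = "\<lambda>_. {}" and B = B])
    show "tree_graph T" using dec unfolding tree_decomposition_def by auto
    show "finite (B t) \<and> card (B t) \<le> k" if "t \<in> verts T" for t
    proof -
      have "B t \<subseteq> verts G" using un that by blast
      then show ?thesis using bag[OF that] finite_subset[OF _ fin] by auto
    qed
    show "connected_in T {t \<in> verts T. v \<in> B t}" for v
    proof (cases "v \<in> verts G")
      case True then show ?thesis using dec unfolding tree_decomposition_def by auto
    next
      case False
      then have "{t \<in> verts T. v \<in> B t} = {}" using un by auto
      then show ?thesis by (metis (no_types, lifting) connected_in_def empty_iff)
    qed
    show "\<exists>t\<in>verts T. u \<in> {} \<union> B t \<and> v \<in> {} \<union> B t" if "{u, v} \<in> edges G" for u v
    proof -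
      have "\<exists>t\<in>verts T. {u, v} \<subseteq> B t" using dec that unfolding tree_decomposition_def by blast
      then show ?thesis by auto
    qed
  qed (use W fin un finite_subset[OF W(1)] in auto)
  then obtain A S where "A \<subseteq> verts G" "S \<subseteq> verts G" "A \<inter> S = {}" "card S \<le> k"
    "\<tau> \<le> card (A \<inter> W)" "card (A \<inter> W) \<le> 2 * \<tau> + k"
    "\<forall>u v. {u, v} \<in> edges G \<longrightarrow> u \<in> A \<longrightarrow> v \<in> A \<union> S"
    by (elim exE conjE)
  then show ?thesis by (intro that[of A S]) simp_all
qed

section \<open>Path decompositions and cutwidth\<close>

definition path_graph :: "nat \<Rightarrow> nat graph" where
  "path_graph N = ({..N}, {{i, Suc i} |i. i < N})"

lemma connected_in_path_graph:
  assumes "b \<le> N"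
  shows "connected_in (path_graph N) {a..b}"
  using assms
proof (induction b)
  case 0
  have "{a..0} = {} \<or> {a..0} = {0}" by (cases a) auto
  then show ?case by (auto simp: connected_in_def)
next
  case (Suc b)
  consider "a \<le> b" | "a = Suc b" | "a > Suc b" by linarith
  then show ?case
  proof cases
    case 1
    have "connected_in (path_graph N) (insert (Suc b) {a..b})"
      by (rule connected_in_insert[of _ _ b]) (use Suc 1 in \<open>auto simp: path_graph_def\<close>)
    moreover have "{a..Suc b} = insert (Suc b) {a..b}" using 1 by auto
    ultimately show ?thesis by simp
  qed (auto simp: connected_in_def)
qed

text \<open>In a cycle the two neighbours of the largest vertex would both be its predecessor.\<close>

lemma tree_graph_path_graph: "tree_graph (path_graph N)"
proof -
  have "False" if c: "graph_cycle (path_graph N) vs" for vs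
  proof -
    let ?n = "length vs"
    have n: "?n \<ge> 3" and d: "distinct vs"
      and e: "\<And>i. i < ?n \<Longrightarrow> {vs ! i, vs ! (Suc i mod ?n)} \<in> edges (path_graph N)"
      using c unfolding graph_cycle_def by auto
    define M where "M = Max (set vs)"
    have "M \<in> set vs" unfolding M_def by (rule Max_in) (use n in auto)
    then obtain i where i: "i < ?n" "vs ! i = M" by (auto simp: in_set_conv_nth)
    have nb: "Suc (vs ! j) = M" if "j < ?n" "{M, vs ! j} \<in> edges (path_graph N)" for j
    proof -
      have "vs ! j \<le> M" unfolding M_def using that by (intro Max_ge) auto
      then show ?thesis using that(2) by (auto simp: path_graph_def doubleton_eq_iff)
    qed
    define j where "j = (if i = 0 then ?n - 1 else i - 1)"
    have j: "j < ?n" "Suc j mod ?n = i" using i n by (auto simp: j_def)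
    have nx: "Suc i mod ?n < ?n" using n by (intro mod_less_divisor) auto
    have "Suc (vs ! (Suc i mod ?n)) = M" using nb[OF nx] e[OF i(1)] i(2) by simp
    moreover have "Suc (vs ! j) = M" using nb[OF j(1)] e[OF j(1)] i(2) j(2) by (simp add: insert_commute)
    ultimately have "vs ! (Suc i mod ?n) = vs ! j" by simp
    then have "Suc i mod ?n = j" using d nx j(1) by (simp add: nth_eq_iff_index_eq)
    moreover have "Suc i mod ?n = (if Suc i = ?n then 0 else Suc i)" using i by auto
    ultimately show False using n i by (auto simp: j_def split: if_splits)
  qed
  moreover have "connected_in (path_graph N) {..N}"
    using connected_in_path_graph[of N N 0] by (simp add: atLeast0AtMost)
  ultimately show ?thesis
    unfolding tree_graph_def simple_graph_def by (auto simp: path_graph_def)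
qed

lemma finite_edges: "simple_graph G \<Longrightarrow> finite (edges G)"
  unfolding simple_graph_def by (rule finite_subset[of _ "Pow (verts G)"]) auto

lemma cut_size_le_card_edges: "finite (edges G) \<Longrightarrow> cut_size G f x \<le> card (edges G)"
  unfolding cut_size_def by (rule card_mono) auto

lemma finite_range_cut_size: "finite (edges G) \<Longrightarrow> finite (range (cut_size G f))"
  by (rule finite_subset[of _ "{..card (edges G)}"]) (auto simp: cut_size_le_card_edges)

text \<open>Reading the vertices along \<open>f\<close>, the bag at a place holds the vertex at that place together
  with the earlier vertices that still have a neighbour to come; distinct earlier vertices are the
  lower ends of distinct edges of one cut.\<close>

lemma cut_path_decomposition:
  assumes G: "simple_graph G" "verts G \<noteq> {}" and inj: "inj_on f (verts G)"
  obtains N B where "tree_decomposition G (path_graph N) B"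
    "decomposition_width (path_graph N) B \<le> Max (range (cut_size G f))"
proof -
  let ?V = "verts G" and ?E = "edges G"
  have finV: "finite ?V" using G unfolding simple_graph_def by auto
  have E: "e \<subseteq> ?V \<and> card e = 2" if "e \<in> ?E" for e using G that unfolding simple_graph_def by auto
  define m where "m = Min (f ` ?V)"
  define pos where "pos v = nat (f v - m)" for v
  define N where "N = Max (pos ` ?V)"
  have fpos: "f v = m + int (pos v)" if "v \<in> ?V" for v
    using that finV by (auto simp: pos_def m_def)
  have pN: "pos v \<le> N" if "v \<in> ?V" for v using that finV by (auto simp: N_def)
  have pinj: "u = v" if "u \<in> ?V" "v \<in> ?V" "pos u = pos v" for u v
    using inj fpos that by (metis inj_onD)
  define F where "F i = {v \<in> ?V. pos v < i \<and> (\<exists>u\<in>?V. {u, v} \<in> ?E \<and> i \<le> pos u)}" for i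
  define B where "B i = {v \<in> ?V. pos v = i} \<union> F i" for i
  have BV: "B i \<subseteq> ?V" for i by (auto simp: B_def F_def)
  have vpos: "v \<in> B (pos v)" if "v \<in> ?V" for v using that by (auto simp: B_def)
  have "tree_decomposition G (path_graph N) B"
    unfolding tree_decomposition_def
  proof (intro conjI ballI tree_graph_path_graph)
    show "(\<Union>t\<in>verts (path_graph N). B t) = ?V"
      using BV vpos pN by (auto simp: path_graph_def) blast
  next
    fix e assume e: "e \<in> ?E"
    obtain a b where ab: "e = {a, b}" "a \<noteq> b" using E[OF e] by (auto simp: card_2_iff)
    have V: "a \<in> ?V" "b \<in> ?V" using E[OF e] ab by auto
    have *: "{u, v} \<subseteq> B (pos v)" if "u \<in> ?V" "v \<in> ?V" "{v, u} \<in> ?E" "pos u < pos v" for u v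
      using that by (auto simp: B_def F_def)
    have "pos a \<noteq> pos b" using pinj V ab by auto
    then have "e \<subseteq> B (pos b) \<or> e \<subseteq> B (pos a)"
      using *[of a b] *[of b a] V e ab by (auto simp: insert_commute linorder_neq_iff)
    then show "\<exists>t\<in>verts (path_graph N). e \<subseteq> B t"
      using pN V by (auto simp: path_graph_def)
  next
    fix v assume v: "v \<in> ?V"
    let ?X = "{t \<in> verts (path_graph N). v \<in> B t}"
    have fin: "finite ?X" by (simp add: path_graph_def)
    have px: "pos v \<in> ?X" using v vpos pN by (auto simp: path_graph_def)
    have M: "Max ?X \<in> ?X" using fin px by (intro Max_in) auto
    have "?X = {pos v..Max ?X}"
    proof
      show "?X \<subseteq> {pos v..Max ?X}"
      proof
        fix t assume t: "t \<in> ?X"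
        then have "pos v \<le> t" by (auto simp: B_def F_def)
        then show "t \<in> {pos v..Max ?X}" using Max_ge[OF fin t] by simp
      qed
      show "{pos v..Max ?X} \<subseteq> ?X"
      proof
        fix j assume j: "j \<in> {pos v..Max ?X}"
        have "j \<le> N" using j M by (auto simp: path_graph_def)
        moreover have "v \<in> B j"
        proof (cases "j = pos v")
          case True then show ?thesis using v vpos by auto
        next
          case False
          then have "pos v < j" "j \<le> Max ?X" using j by auto
          moreover have "v \<in> B (Max ?X)" using M by auto
          ultimately show ?thesis using v by (fastforce simp: B_def F_def)
        qed
        ultimately show "j \<in> ?X" by (auto simp: path_graph_def)
      qed
    qed
    moreover have "Max ?X \<le> N" using M by (auto simp: path_graph_def)
    ultimately show "connected_in (path_graph N) ?X" using connected_in_path_graph by metis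
  qed
  moreover have "card (B i) \<le> Max (range (cut_size G f)) + 1" for i
  proof -
    let ?x = "real_of_int (m + int i - 1)"
    let ?C = "{e \<in> ?E. \<exists>a b. e = {a, b} \<and> real_of_int (f a) \<le> ?x \<and> ?x < real_of_int (f b)}"
    have "\<forall>v\<in>F i. \<exists>u. u \<in> ?V \<and> {u, v} \<in> ?E \<and> i \<le> pos u" by (auto simp: F_def)
    then obtain g where g: "\<forall>v\<in>F i. g v \<in> ?V \<and> {g v, v} \<in> ?E \<and> i \<le> pos (g v)" by metis
    have lt: "v \<in> ?V \<and> pos v < i" if "v \<in> F i" for v using that by (auto simp: F_def)
    have "card (F i) \<le> card ?C"
    proof (rule card_inj_on_le[of "\<lambda>v. {g v, v}"])
      show "inj_on (\<lambda>v. {g v, v}) (F i)"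
      proof (rule inj_onI)
        fix v w assume vw: "v \<in> F i" "w \<in> F i" "{g v, v} = {g w, w}"
        have "w \<noteq> g v" using lt[OF vw(2)] g vw(1) by auto
        then show "v = w" using vw(3) by (auto simp: doubleton_eq_iff)
      qed
      show "(\<lambda>v. {g v, v}) ` F i \<subseteq> ?C"
      proof safe
        fix v assume v: "v \<in> F i"
        show "{g v, v} \<in> ?E" using g v by auto
        have "f v \<le> m + int i - 1" "m + int i - 1 < f (g v)"
          using fpos lt[OF v] g v by force+
        then show "\<exists>a b. {g v, v} = {a, b} \<and> real_of_int (f a) \<le> ?x \<and> ?x < real_of_int (f b)"
          by (intro exI[of _ v] exI[of _ "g v"]) (simp only: insert_commute of_int_le_iff of_int_less_iff)
      qed
      show "finite ?C" using finite_edges[OF G(1)] by simp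
    qed
    also have "\<dots> = cut_size G f ?x" by (simp add: cut_size_def)
    also have "\<dots> \<le> Max (range (cut_size G f))"
      by (rule Max_ge) (use finite_range_cut_size[OF finite_edges[OF G(1)]] in auto)
    finally have F: "card (F i) \<le> Max (range (cut_size G f))" .
    have "card {v \<in> ?V. pos v = i} \<le> 1"
      using pinj finV by (auto simp: card_le_Suc0_iff_eq)
    then show ?thesis using F card_Un_le[of "{v \<in> ?V. pos v = i}" "F i"] unfolding B_def by linarith
  qed
  then have "decomposition_width (path_graph N) B \<le> Max (range (cut_size G f))"
    unfolding decomposition_width_def
    by (subst le_diff_conv, subst Max_le_iff) (auto simp: path_graph_def)
  ultimately show ?thesis using that by blast
qed

lemma ex_inj_int: "finite V \<Longrightarrow> \<exists>f :: 'a \<Rightarrow> int. inj_on f V"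
proof -
  assume "finite V"
  then obtain f :: "'a \<Rightarrow> nat" where "inj_on f V" using finite_imp_inj_to_nat_seg by metis
  then have "inj_on (int \<circ> f) V" by (intro comp_inj_on) auto
  then show ?thesis by blast
qed

lemma treewidth_le_cutwidth:
  assumes "simple_graph G" "verts G \<noteq> {}"
  shows "treewidth G \<le> cutwidth G"
proof -
  have "\<exists>f. inj_on f (verts G) \<and> Max (range (cut_size G f)) = cutwidth G"
    unfolding cutwidth_def
    by (rule LeastI_ex) (use ex_inj_int assms in \<open>auto simp: simple_graph_def\<close>)
  then obtain f where f: "inj_on f (verts G)" "Max (range (cut_size G f)) = cutwidth G" by auto
  obtain N B where NB: "tree_decomposition G (path_graph N) B"
    "decomposition_width (path_graph N) B \<le> Max (range (cut_size G f))"
    using cut_path_decomposition[OF assms f(1)] by metis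
  have "treewidth G \<le> decomposition_width (path_graph N) B"
    unfolding treewidth_def by (rule Least_le) (use NB in blast)
  then show ?thesis using NB f by simp
qed

lemma treewidth_attained:
  assumes "simple_graph G" "verts G \<noteq> {}"
  obtains T :: "nat graph" and B where "tree_decomposition G T B"
    "\<And>t. t \<in> verts T \<Longrightarrow> card (B t) \<le> treewidth G + 1"
proof -
  obtain f :: "'a \<Rightarrow> int" where "inj_on f (verts G)"
    using ex_inj_int assms unfolding simple_graph_def by metis
  then obtain N B where "tree_decomposition G (path_graph N) B"
    using cut_path_decomposition[OF assms] by metis
  then have "\<exists>k. \<exists>(T :: nat graph) B. tree_decomposition G T B \<and> decomposition_width T B = k"
    by blast
  then have "\<exists>(T :: nat graph) B. tree_decomposition G T B \<and> decomposition_width T B = treewidth G"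
    unfolding treewidth_def by (rule LeastI_ex)
  then obtain T :: "nat graph" and B where TB: "tree_decomposition G T B" "decomposition_width T B = treewidth G"
    by blast
  have "card (B t) \<le> treewidth G + 1" if "t \<in> verts T" for t
  proof -
    have "finite (verts T)"
      using TB unfolding tree_decomposition_def tree_graph_def simple_graph_def by auto
    then have "card (B t) \<le> Max ((\<lambda>t. card (B t)) ` verts T)" using that by (intro Max_ge) auto
    then show ?thesis using TB(2) unfolding decomposition_width_def by simp
  qed
  then show ?thesis using that TB by blast
qed

lemma cutwidth_le:
  assumes "inj_on f (verts G)" "finite (edges G)" "\<And>x. cut_size G f x \<le> c"
  shows "cutwidth G \<le> c"
proof -
  have "cutwidth G \<le> Max (range (cut_size G f))"
    unfolding cutwidth_def by (rule Least_le) (use assms in blast)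
  also have "\<dots> \<le> c" using assms(3) finite_range_cut_size[OF assms(2)] by (subst Max_le_iff) auto
  finally show ?thesis .
qed

section \<open>The tangled path\<close>

lemma simple_graph_tangled_path:
  assumes "\<sigma> permutes {1..n}"
  shows "simple_graph (tangled_path n \<sigma>)"
proof -
  have "\<sigma> i \<noteq> \<sigma> (Suc i)" for i using permutes_inj[OF assms] by (metis injD n_not_Suc_n)
  moreover have "\<sigma> i \<in> {1..n}" if "i \<in> {1..n}" for i using permutes_in_image[OF assms] that by blast
  ultimately show ?thesis unfolding simple_graph_def tangled_path_def by fastforce
qed

lemma card_edges_tangled_path: "card (edges (tangled_path n \<sigma>)) \<le> 2 * n"
proof -
  have "edges (tangled_path n \<sigma>) = (\<lambda>i. {i, i + 1}) ` {1..<n} \<union> (\<lambda>i. {\<sigma> i, \<sigma> (i + 1)}) ` {1..<n}"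
    by (auto simp: tangled_path_def)
  also have "card \<dots> \<le> card {1..<n} + card {1..<n}"
    by (rule order_trans[OF card_Un_le]) (intro add_mono card_image_le; simp)
  finally show ?thesis by simp
qed

lemma cutwidth_tangled_path_le_2n:
  assumes "\<sigma> permutes {1..n}" shows "cutwidth (tangled_path n \<sigma>) \<le> 2 * n"
proof (rule cutwidth_le[of int])
  show fin: "finite (edges (tangled_path n \<sigma>))"
    using finite_edges simple_graph_tangled_path assms by blast
  show "cut_size (tangled_path n \<sigma>) int x \<le> 2 * n" for x
    using cut_size_le_card_edges[OF fin] card_edges_tangled_path order_trans by blast
qed auto

text \<open>For \<open>x = y\<close> this counts the values that end up on the wrong side of \<open>x\<close>; the recursion for appended
  values needs the two thresholds to be independent.\<close>

definition late_low :: "nat \<Rightarrow> nat \<Rightarrow> nat \<Rightarrow> (nat \<Rightarrow> nat) \<Rightarrow> nat" where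
  "late_low n x y \<sigma> = card {i \<in> {x<..n}. \<sigma> i \<le> y}"

text \<open>Positions up to \<open>x\<close> and values up to \<open>x\<close> are equally many, so the exceptions on the two sides
  balance.\<close>

lemma card_early_high:
  assumes "\<sigma> permutes {1..n}" "x \<le> n"
  shows "card {i \<in> {1..x}. x < \<sigma> i} = late_low n x x \<sigma>"
proof -
  let ?M = "{i \<in> {1..x}. \<sigma> i \<le> x}"
  have "card {i \<in> {1..n}. \<sigma> i \<in> {1..x}} = card {1..x}"
  proof (rule bij_betw_same_card[of \<sigma>])
    have "\<sigma> ` {i \<in> {1..n}. \<sigma> i \<in> {1..x}} = {1..x}"
    proof -
      have "\<sigma> ` {1..n} = {1..n}" using permutes_image[OF assms(1)] .
      then show ?thesis using assms(2) by (auto simp: set_eq_iff image_iff) (metis atLeastAtMost_iff order_trans)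
    qed
    then show "bij_betw \<sigma> {i \<in> {1..n}. \<sigma> i \<in> {1..x}} {1..x}"
      using permutes_inj_on[OF assms(1)] unfolding bij_betw_def by auto
  qed
  moreover have "{i \<in> {1..n}. \<sigma> i \<in> {1..x}} = ?M \<union> {i \<in> {x<..n}. \<sigma> i \<le> x}"
  proof -
    have "1 \<le> \<sigma> i" if "i \<in> {1..n}" for i using permutes_in_image[OF assms(1), of i] that by auto
    then show ?thesis using assms(2) by force
  qed
  moreover have "card (?M \<union> {i \<in> {x<..n}. \<sigma> i \<le> x}) = card ?M + late_low n x x \<sigma>"
    unfolding late_low_def by (rule card_Un_disjoint) auto
  moreover have "card (?M \<union> {i \<in> {1..x}. x < \<sigma> i}) = card ?M + card {i \<in> {1..x}. x < \<sigma> i}"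
    by (rule card_Un_disjoint) auto
  moreover have "?M \<union> {i \<in> {1..x}. x < \<sigma> i} = {1..x}" by auto
  ultimately show ?thesis by simp
qed

text \<open>Apart from \<open>{x, x + 1}\<close> and the edge between the positions \<open>x\<close> and \<open>x + 1\<close>, a crossing edge has an end
  at one of at most \<open>2 * d\<close> positions that lie on one side of \<open>x\<close> and have their value on the other, and each
  such position is an end of at most two edges.\<close>

lemma cut_size_tangled_path:
  assumes \<sigma>: "\<sigma> permutes {1..n}" and late: "\<And>x. x \<le> n \<Longrightarrow> late_low n x x \<sigma> \<le> d"
  shows "cut_size (tangled_path n \<sigma>) int y \<le> 4 * d + 2"
proof -
  let ?E = "edges (tangled_path n \<sigma>)"
  let ?C = "{e \<in> ?E. \<exists>i j. e = {i, j} \<and> real_of_int (int i) \<le> y \<and> y < real_of_int (int j)}"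
  have Edef: "?E = {{i, i + 1} |i. 1 \<le> i \<and> i < n} \<union> {{\<sigma> i, \<sigma> (i + 1)} |i. 1 \<le> i \<and> i < n}"
    by (simp add: tangled_path_def)
  have Esub: "e \<subseteq> {1..n}" if "e \<in> ?E" for e
    using simple_graph_tangled_path[OF \<sigma>] that unfolding simple_graph_def by (auto simp: tangled_path_def)
  show ?thesis
  proof (cases "0 \<le> y \<and> y < real n")
    case False
    then have "?C = {}" using Esub by fastforce
    then show ?thesis unfolding cut_size_def by (metis card.empty zero_le)
  next
    case True
    define x where "x = nat \<lfloor>y\<rfloor>"
    have le: "real_of_int (int i) \<le> y \<longleftrightarrow> i \<le> x" for i
      using True by (simp add: x_def le_nat_iff le_floor_iff)
    have lt: "y < real_of_int (int i) \<longleftrightarrow> x < i" for i using le[of i] by linarith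
    have xn: "x \<le> n" using True lt[of n] by simp
    define P where "P = {i \<in> {1..x}. x < \<sigma> i} \<union> {i \<in> {x<..n}. \<sigma> i \<le> x}"
    have "card P \<le> card {i \<in> {1..x}. x < \<sigma> i} + card {i \<in> {x<..n}. \<sigma> i \<le> x}"
      unfolding P_def by (rule card_Un_le)
    also have "\<dots> \<le> 2 * d" using card_early_high[OF \<sigma> xn] late[OF xn] by (simp add: late_low_def)
    finally have P: "card P \<le> 2 * d" .
    have finP: "finite P" by (simp add: P_def)
    let ?h = "\<lambda>i. {\<sigma> i, \<sigma> (i + 1)}"
    let ?Q = "P \<union> (\<lambda>i. i - 1) ` P \<union> {x}"
    have "?C \<subseteq> insert {x, x + 1} (?h ` ?Q)"
    proof
      fix e assume "e \<in> ?C"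
      then obtain i j where e: "e \<in> ?E" "e = {i, j}" "i \<le> x" "x < j"
        unfolding mem_Collect_eq le lt by blast
      from e(1) consider k where "e = {k, k + 1}" | k where "1 \<le> k" "k < n" "e = ?h k"
        by (auto simp: Edef)
      then show "e \<in> insert {x, x + 1} (?h ` ?Q)"
      proof cases
        case (1 k)
        then have "k = x" using e by (auto simp: doubleton_eq_iff)
        then show ?thesis using 1 by auto
      next
        case (2 k)
        then have cross: "(\<sigma> k \<le> x \<and> x < \<sigma> (k + 1)) \<or> (\<sigma> (k + 1) \<le> x \<and> x < \<sigma> k)"
          using e by (auto simp: doubleton_eq_iff)
        have "k \<in> ?Q"
        proof (rule ccontr)
          assume "k \<notin> ?Q"
          then have nk: "k \<notin> P" "k \<noteq> x" "k + 1 \<notin> P"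
            by (auto simp: image_iff)
          then show False using cross 2 unfolding P_def by auto
        qed
        then show ?thesis using 2 by auto
      qed
    qed
    then have "card ?C \<le> card (insert {x, x + 1} (?h ` ?Q))"
      by (rule card_mono[rotated]) (use finP in auto)
    also have "\<dots> \<le> Suc (card (?h ` ?Q))" by (simp add: card_insert_if finP)
    also have "card (?h ` ?Q) \<le> card ?Q" by (rule card_image_le) (use finP in auto)
    also have "card ?Q \<le> card P + card ((\<lambda>i. i - 1) ` P) + card {x}"
      by (meson add_le_mono1 card_Un_le order_trans)
    also have "\<dots> \<le> card P + card P + 1"
      using card_image_le[OF finP] by simp
    finally show ?thesis using P unfolding cut_size_def by simp
  qed
qed

lemma cutwidth_tangled_path_le:
  assumes "\<sigma> permutes {1..n}" "\<And>x. x \<le> n \<Longrightarrow> late_low n x x \<sigma> \<le> d"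
  shows "cutwidth (tangled_path n \<sigma>) \<le> 4 * d + 2"
proof (rule cutwidth_le[of int])
  show "finite (edges (tangled_path n \<sigma>))"
    using finite_edges simple_graph_tangled_path assms by blast
qed (use cut_size_tangled_path assms in auto)

lemma treewidth_tangled_path_ge_1:
  assumes \<sigma>: "\<sigma> permutes {1..n}" and "n \<ge> 2"
  shows "treewidth (tangled_path n \<sigma>) \<ge> 1"
proof -
  have "simple_graph (tangled_path n \<sigma>)" "verts (tangled_path n \<sigma>) \<noteq> {}"
    using simple_graph_tangled_path[OF \<sigma>] assms(2) by (auto simp: tangled_path_def)
  from treewidth_attained[OF this]
  obtain T :: "nat graph" and B where TB: "tree_decomposition (tangled_path n \<sigma>) T B"
    "\<And>t. t \<in> verts T \<Longrightarrow> card (B t) \<le> treewidth (tangled_path n \<sigma>) + 1" by metis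
  have "{1, 1 + 1} \<in> edges (tangled_path n \<sigma>)" using assms(2) unfolding tangled_path_def by auto
  then obtain t where t: "t \<in> verts T" "{1, 1 + 1} \<subseteq> B t"
    using TB(1) unfolding tree_decomposition_def by blast
  have "B t \<subseteq> {1..n}" using TB(1) t unfolding tree_decomposition_def tangled_path_def by auto
  then have "card {1, 1 + 1 :: nat} \<le> card (B t)" by (intro card_mono t(2)) (rule finite_subset, auto)
  then show ?thesis using TB(2)[OF t(1)] by simp
qed

section \<open>Permutations with a small separator are rare\<close>

definition path_split :: "nat \<Rightarrow> nat set \<Rightarrow> nat set \<Rightarrow> bool" where
  "path_split m A S \<longleftrightarrow> A \<subseteq> {1..m} \<and> S \<subseteq> {1..m} \<and> A \<inter> S = {} \<and>
     (\<forall>i\<in>{1..<m}. i \<in> S \<or> Suc i \<in> S \<or> (i \<in> A \<longleftrightarrow> Suc i \<in> A))"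

text \<open>The set \<open>S\<close> separates \<open>A\<close> from the remaining vertices in both paths of \<open>tangled_path m \<rho>\<close>.\<close>

definition separated :: "nat \<Rightarrow> nat \<Rightarrow> nat \<Rightarrow> (nat \<Rightarrow> nat) \<Rightarrow> bool" where
  "separated m k s \<rho> \<longleftrightarrow> (\<exists>A S. path_split m A S \<and> card S \<le> k \<and> s \<le> card A \<and> card A + s \<le> m \<and>
     (\<forall>i\<in>{1..<m}. \<rho> i \<in> S \<or> \<rho> (Suc i) \<in> S \<or> (\<rho> i \<in> A \<longleftrightarrow> \<rho> (Suc i) \<in> A)))"

text \<open>Along the path, membership in \<open>A\<close> can only change at a vertex of \<open>S\<close>. So \<open>A\<close> is known once it is
  known for the vertex 1 and for the successors of the vertices of \<open>S\<close>.\<close>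

lemma path_split_determined:
  assumes "path_split m A S" "path_split m A' S"
    and "{s \<in> insert 0 S. Suc s \<in> A} = {s \<in> insert 0 S. Suc s \<in> A'}"
  shows "A = A'"
proof -
  have "i \<in> A \<longleftrightarrow> i \<in> A'" for i
  proof (induction i)
    case 0
    then show ?case using assms unfolding path_split_def by auto
  next
    case (Suc i)
    consider "i \<in> insert 0 S" | "Suc i \<in> S" | "Suc i > m" | "i \<in> {1..<m}" "i \<notin> S" "Suc i \<notin> S"
      by (cases i) force+
    then show ?case
    proof cases
      case 1
      have "i \<in> {s \<in> insert 0 S. Suc s \<in> A} \<longleftrightarrow> i \<in> {s \<in> insert 0 S. Suc s \<in> A'}"
        using assms(3) by simp
      then show ?thesis using 1 by simp
    next
      case 2 then show ?thesis using assms unfolding path_split_def by blast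
    next
      case 3 then show ?thesis using assms unfolding path_split_def by fastforce
    next
      case 4 then show ?thesis using assms Suc unfolding path_split_def by blast
    qed
  qed
  then show ?thesis by blast
qed

lemma sum_power_card_Pow:
  fixes c :: real
  assumes "finite U"
  shows "(\<Sum>X\<in>Pow U. c ^ card X) = (1 + c) ^ card U"
proof -
  have "(1 + c) ^ card U = (\<Prod>x\<in>U. c + 1)" by (simp add: add.commute)
  also have "\<dots> = (\<Sum>X\<in>Pow U. (\<Prod>x\<in>X. c) * (\<Prod>x\<in>U - X. 1))" by (rule prod_add[OF assms])
  finally show ?thesis by simp
qed

text \<open>A set \<open>S\<close> admits at most \<open>2 ^ (card S + 1)\<close> splits. Counting \<open>S\<close> with weight
  \<open>t ^ card S / t ^ k\<close>, which is at least 1 for the sets in question, replaces the sum of binomial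
  coefficients by a power.\<close>

lemma card_path_splits:
  fixes t :: real
  assumes "0 < t" "t \<le> 1"
  shows "finite {(A, S). path_split m A S \<and> card S \<le> k}" (is "finite ?T")
    and "real (card {(A, S). path_split m A S \<and> card S \<le> k}) \<le> 2 * (1 + 2 * t) ^ m / t ^ k"
proof -
  let ?U = "{1..m}"
  let ?D = "SIGMA S:{S \<in> Pow ?U. card S \<le> k}. Pow (insert 0 S)"
  let ?f = "\<lambda>(A, S). (S, {s \<in> insert 0 S. Suc s \<in> A})"
  have inj: "inj_on ?f ?T"
    using path_split_determined by (auto simp: inj_on_def)
  have sub: "?f ` ?T \<subseteq> ?D" by (auto simp: path_split_def)
  have finD: "finite ?D" by (intro finite_SigmaI) (auto intro: finite_subset)
  show "finite ?T" using inj_on_finite[OF inj sub finD] .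
  have "card ?T \<le> card ?D" using card_inj_on_le[OF inj sub finD] .
  also have "card ?D = (\<Sum>S | S \<in> Pow ?U \<and> card S \<le> k. card (Pow (insert 0 S)))"
    by (rule card_SigmaI) (auto intro: finite_subset)
  finally have "real (card ?T) \<le> (\<Sum>S | S \<in> Pow ?U \<and> card S \<le> k. real (card (Pow (insert 0 S))))"
    by (simp only: of_nat_sum[symmetric] of_nat_le_iff)
  also have "\<dots> \<le> (\<Sum>S | S \<in> Pow ?U \<and> card S \<le> k. 2 * (2 * t) ^ card S / t ^ k)"
  proof (rule sum_mono)
    fix S assume "S \<in> {S. S \<in> Pow ?U \<and> card S \<le> k}"
    then have S: "S \<subseteq> ?U" "card S \<le> k" by auto
    then have "finite S" "0 \<notin> S" using finite_subset by auto
    then have "real (card (Pow (insert 0 S))) = 2 * 2 ^ card S" by (simp add: card_Pow)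
    also have "\<dots> \<le> 2 * 2 ^ card S * (t ^ card S / t ^ k)"
      using power_decreasing[OF S(2), of t] assms by (simp add: field_simps)
    also have "\<dots> = 2 * (2 * t) ^ card S / t ^ k" by (simp add: power_mult_distrib)
    finally show "real (card (Pow (insert 0 S))) \<le> 2 * (2 * t) ^ card S / t ^ k" .
  qed
  also have "\<dots> \<le> (\<Sum>S\<in>Pow ?U. 2 * (2 * t) ^ card S / t ^ k)"
    by (rule sum_mono2) (use assms in auto)
  also have "\<dots> = 2 * (1 + 2 * t) ^ m / t ^ k"
    using sum_power_card_Pow[of ?U "2 * t"] by (simp flip: sum_distrib_left sum_divide_distrib)
  finally show "real (card ?T) \<le> 2 * (1 + 2 * t) ^ m / t ^ k" .
qed

lemma permutes_moving_subset:
  assumes "finite U" "A \<subseteq> U" "C \<subseteq> U" "card A = card C"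
  obtains \<tau> where "\<tau> permutes U" "\<tau> ` A = C"
proof -
  have fin: "finite A" "finite C" using assms finite_subset by auto
  obtain f where f: "bij_betw f A C" using finite_same_card_bij[OF fin assms(4)] by auto
  have "card (U - A) = card (U - C)" using assms fin by (simp add: card_Diff_subset)
  then obtain g where g: "bij_betw g (U - A) (U - C)"
    using finite_same_card_bij[of "U - A" "U - C"] assms by auto
  define \<tau> where "\<tau> x = (if x \<in> A then f x else if x \<in> U then g x else x)" for x
  have A: "bij_betw \<tau> A C" using f by (rule bij_betw_cong[THEN iffD1, rotated]) (simp add: \<tau>_def)
  have B: "bij_betw \<tau> (U - A) (U - C)" using g by (rule bij_betw_cong[THEN iffD1, rotated]) (simp add: \<tau>_def)
  have "bij_betw \<tau> (A \<union> (U - A)) (C \<union> (U - C))" by (rule bij_betw_combine[OF A B]) auto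
  then have "\<tau> permutes U"
    using assms by (intro bij_imp_permutes) (auto simp: \<tau>_def Un_absorb1)
  then show ?thesis using that A by (auto simp: bij_betw_def)
qed

text \<open>By symmetry, every set of the size of \<open>A\<close> is the image of \<open>A'\<close> under equally many permutations.\<close>

lemma card_permutes_image_eq:
  assumes U: "finite U" "A \<subseteq> U"
  shows "card {\<rho>. \<rho> permutes U \<and> \<rho> ` A' = A} * (card U choose card A) \<le> fact (card U)"
proof -
  let ?N = "\<lambda>C. {\<rho>. \<rho> permutes U \<and> \<rho> ` A' = C}"
  let ?\<C> = "{C. C \<subseteq> U \<and> card C = card A}"
  have finP: "finite {\<rho>. \<rho> permutes U}" using finite_permutations[OF U(1)] .
  have finN: "finite (?N C)" for C by (rule finite_subset[OF _ finP]) auto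
  have finC: "finite ?\<C>" using U by auto
  have "card (?N A) \<le> card (?N C)" if C: "C \<in> ?\<C>" for C
  proof -
    obtain \<tau> where \<tau>: "\<tau> permutes U" "\<tau> ` A = C"
      using permutes_moving_subset[OF U(1) U(2), of C] C by auto
    show ?thesis
    proof (rule card_inj_on_le[of "\<lambda>\<rho>. \<tau> \<circ> \<rho>"])
      show "inj_on (\<lambda>\<rho>. \<tau> \<circ> \<rho>) (?N A)"
        using permutes_inj[OF \<tau>(1)] by (auto intro!: inj_onI simp: fun.inj_map_strong fun_eq_iff injD)
      show "(\<lambda>\<rho>. \<tau> \<circ> \<rho>) ` ?N A \<subseteq> ?N C"
        using \<tau> by (auto intro: permutes_compose simp: image_comp[symmetric])
    qed (rule finN)
  qed
  then have "card ?\<C> * card (?N A) \<le> (\<Sum>C\<in>?\<C>. card (?N C))"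
    using sum_bounded_below[of ?\<C> "card (?N A)" "\<lambda>C. card (?N C)"] by simp
  also have "\<dots> = card (\<Union>C\<in>?\<C>. ?N C)"
    by (rule card_UN_disjoint[symmetric]) (use finC finN in auto)
  also have "\<dots> \<le> card {\<rho>. \<rho> permutes U}"
    by (rule card_mono[OF finP]) auto
  also have "\<dots> = fact (card U)" using card_permutations[OF _ U(1)] by simp
  finally show ?thesis using n_subsets[OF U(1), of "card A"] by (simp add: mult.commute)
qed

lemma binomial_ge_power_2:
  assumes "s \<le> a" "a + s \<le> m"
  shows "2 ^ s \<le> m choose a"
proof -
  have *: "2 ^ s \<le> m choose b" if "s \<le> b" "2 * b \<le> m" for b
  proof (cases "b = 0")
    case False
    have "2 * real b \<le> real m" using that(2) by linarith
    then have "2 \<le> real m / real b" using False by (simp add: le_divide_eq)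
    then have "(2::real) ^ b \<le> (real m / real b) ^ b" by (rule power_mono) simp
    also have "\<dots> \<le> real (m choose b)" using that by (intro binomial_ge_n_over_k_pow_k) simp
    finally have "(2::nat) ^ b \<le> m choose b" by (metis of_nat_le_iff of_nat_numeral of_nat_power)
    moreover have "(2::nat) ^ s \<le> 2 ^ b" using that(1) by (intro power_increasing) auto
    ultimately show ?thesis by (rule order_trans[rotated])
  qed (use that in auto)
  show ?thesis
  proof (cases "2 * a \<le> m")
    case True then show ?thesis using * assms by auto
  next
    case False
    then have "2 ^ s \<le> m choose (m - a)" using assms by (intro *) auto
    then show ?thesis using assms by (subst binomial_symmetric) auto
  qed
qed

text \<open>If \<open>A\<close> and \<open>S\<close> witness that \<open>\<rho>\<close> is separated, then their preimages under \<open>\<rho>\<close> split the path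
  \<open>1, ..., m\<close> as well. So \<open>\<rho>\<close> takes one of few splits to another, and each such pair leaves at most
  a fraction \<open>1 / (m choose card A)\<close> of all permutations.\<close>

lemma card_separated:
  fixes t :: real
  assumes t: "0 < t" "t \<le> 1"
  shows "real (card {\<rho>. \<rho> permutes {1..m} \<and> separated m k s \<rho>}) * 2 ^ s
    \<le> (2 * (1 + 2 * t) ^ m / t ^ k)\<^sup>2 * fact m"
proof -
  let ?T = "{(A, S). path_split m A S \<and> card S \<le> k}"
  let ?T2 = "{((A, S), (A', S')). ((A, S), (A', S')) \<in> ?T \<times> ?T \<and> s \<le> card A \<and> card A + s \<le> m}"
  let ?N = "\<lambda>((A, S), (A', S')). {\<rho>. \<rho> permutes {1..m} \<and> \<rho> ` A' = A}"
  have finT: "finite ?T" and cT: "real (card ?T) \<le> 2 * (1 + 2 * t) ^ m / t ^ k"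
    using card_path_splits[OF t, of m k] by auto
  have finT2: "finite ?T2" by (rule finite_subset[of _ "?T \<times> ?T"]) (use finT in auto)
  have finP: "finite {\<rho>. \<rho> permutes {1..m}}" by (simp add: finite_permutations)
  have "{\<rho>. \<rho> permutes {1..m} \<and> separated m k s \<rho>} \<subseteq> (\<Union>x\<in>?T2. ?N x)"
  proof
    fix \<rho> assume "\<rho> \<in> {\<rho>. \<rho> permutes {1..m} \<and> separated m k s \<rho>}"
    then obtain A S where \<rho>: "\<rho> permutes {1..m}" and A: "path_split m A S" "card S \<le> k" "s \<le> card A"
      "card A + s \<le> m"
      "\<forall>i\<in>{1..<m}. \<rho> i \<in> S \<or> \<rho> (Suc i) \<in> S \<or> (\<rho> i \<in> A \<longleftrightarrow> \<rho> (Suc i) \<in> A)"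
      unfolding separated_def by blast
    define A' S' where "A' = {i \<in> {1..m}. \<rho> i \<in> A}" and "S' = {i \<in> {1..m}. \<rho> i \<in> S}"
    have im: "\<rho> ` {i \<in> {1..m}. \<rho> i \<in> X} = X" if "X \<subseteq> {1..m}" for X
    proof -
      have "X \<subseteq> \<rho> ` {1..m}" using that permutes_image[OF \<rho>] by simp
      then show ?thesis by auto
    qed
    have "card S' = card (\<rho> ` S')" by (rule card_image[symmetric]) (rule permutes_inj_on[OF \<rho>])
    also have "\<rho> ` S' = S" using im[of S] A(1) unfolding S'_def path_split_def by auto
    finally have "card S' \<le> k" using A by simp
    moreover have "path_split m A' S'" using A unfolding path_split_def A'_def S'_def by auto
    moreover have "\<rho> ` A' = A" using im[of A] A(1) unfolding A'_def path_split_def by auto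
    ultimately show "\<rho> \<in> (\<Union>x\<in>?T2. ?N x)" using A \<rho>
      by (intro UN_I[of "((A, S), (A', S'))"]) auto
  qed
  then have "card {\<rho>. \<rho> permutes {1..m} \<and> separated m k s \<rho>} \<le> card (\<Union>x\<in>?T2. ?N x)"
    by (rule card_mono[rotated]) (rule finite_subset[OF _ finP], auto)
  also have "\<dots> \<le> (\<Sum>x\<in>?T2. card (?N x))" by (rule card_UN_le[OF finT2])
  finally have "card {\<rho>. \<rho> permutes {1..m} \<and> separated m k s \<rho>} * 2 ^ s \<le> (\<Sum>x\<in>?T2. card (?N x)) * 2 ^ s"
    by simp
  also have "\<dots> = (\<Sum>x\<in>?T2. card (?N x) * 2 ^ s)" by (rule sum_distrib_right)
  also have "\<dots> \<le> (\<Sum>x\<in>?T2. fact m)"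
  proof (rule sum_mono)
    fix x assume "x \<in> ?T2"
    then obtain A S A' S' where x: "x = ((A, S), (A', S'))" "path_split m A S" "s \<le> card A" "card A + s \<le> m"
      by auto
    have "card {\<rho>. \<rho> permutes {1..m} \<and> \<rho> ` A' = A} * 2 ^ s
        \<le> card {\<rho>. \<rho> permutes {1..m} \<and> \<rho> ` A' = A} * (m choose card A)"
      using binomial_ge_power_2[OF x(3,4)] by simp
    also have "\<dots> \<le> fact m"
      using card_permutes_image_eq[of "{1..m}" A A'] x(2) unfolding path_split_def by simp
    finally show "card (?N x) * 2 ^ s \<le> fact m" unfolding x by simp
  qed
  also have "\<dots> = card ?T2 * fact m" by simp
  also have "\<dots> \<le> (card ?T)\<^sup>2 * fact m"
  proof -
    have "card ?T2 \<le> card (?T \<times> ?T)" by (rule card_mono) (use finT in auto)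
    then show ?thesis by (simp add: card_cartesian_product power2_eq_square)
  qed
  finally have "real (card {\<rho>. \<rho> permutes {1..m} \<and> separated m k s \<rho>} * 2 ^ s) \<le> real ((card ?T)\<^sup>2 * fact m)"
    by (rule of_nat_mono)
  also have "\<dots> = (real (card ?T))\<^sup>2 * fact m" by simp
  also have "\<dots> \<le> (2 * (1 + 2 * t) ^ m / t ^ k)\<^sup>2 * fact m"
    by (intro mult_right_mono power_mono cT) auto
  finally show ?thesis by simp
qed

section \<open>Small treewidth separates every block of positions\<close>

definition block_pattern :: "nat \<Rightarrow> nat \<Rightarrow> (nat \<Rightarrow> nat) \<Rightarrow> (nat \<Rightarrow> nat) \<Rightarrow> bool" where
  "block_pattern a m \<sigma> \<rho> \<longleftrightarrow> (\<forall>i\<in>{1..m}. \<forall>j\<in>{1..m}. \<sigma> (a + i) < \<sigma> (a + j) \<longleftrightarrow> \<rho> i < \<rho> j)"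

lemma permutes_rank:
  assumes \<rho>: "\<rho> permutes {1..m}" and i: "i \<in> {1..m}"
  shows "card {j \<in> {1..m}. \<rho> j \<le> \<rho> i} = \<rho> i"
proof -
  have "card {j \<in> {1..m}. \<rho> j \<le> \<rho> i} = card (\<rho> ` {j \<in> {1..m}. \<rho> j \<le> \<rho> i})"
    by (rule card_image[symmetric]) (rule permutes_inj_on[OF \<rho>])
  also have "\<rho> ` {j \<in> {1..m}. \<rho> j \<le> \<rho> i} = \<rho> ` {1..m} \<inter> {..\<rho> i}" by auto
  also have "\<dots> = {1..\<rho> i}"
    using permutes_in_image[OF \<rho>, of i] i permutes_image[OF \<rho>] by auto
  finally show ?thesis by simp
qed

text \<open>Contract the path \<open>1, ..., n\<close> onto the values of the block: a vertex goes to the greatest value of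
  the block that does not exceed it, whose rank among these values is \<open>r x\<close> below; smaller vertices,
  of rank 0, are dropped. A rank is put into \<open>S'\<close> as soon as some vertex of the separator is contracted
  to it, so that outside \<open>S'\<close> a step from one rank to the next is a walk in the tangled path avoiding the
  separator.\<close>

lemma separated_block_of_treewidth_less:
  assumes \<sigma>: "\<sigma> permutes {1..n}" and am: "a + m \<le> n" and \<rho>: "\<rho> permutes {1..m}"
    and pat: "block_pattern a m \<sigma> \<rho>"
    and tw: "treewidth (tangled_path n \<sigma>) < k"
    and \<tau>: "s + k \<le> \<tau>" "2 * \<tau> + k + s \<le> m"
  shows "separated m k s \<rho>"
proof -
  let ?G = "tangled_path n \<sigma>"
  let ?p = "\<lambda>i. \<sigma> (a + i)"
  define W where "W = ?p ` {1..m}"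
  define r where "r x = card {y \<in> W. y \<le> x}" for x
  have finW: "finite W" by (simp add: W_def)
  have \<sigma>inj: "\<sigma> x = \<sigma> y \<longleftrightarrow> x = y" for x y using permutes_inj[OF \<sigma>] by (auto dest: injD)
  have injp: "inj_on ?p X" for X by (auto simp: inj_on_def \<sigma>inj)
  have "m > 0" using \<tau> tw by simp
  then have G: "simple_graph ?G" "verts ?G \<noteq> {}"
    using simple_graph_tangled_path[OF \<sigma>] am by (auto simp: tangled_path_def)
  have Wn: "W \<subseteq> {1..n}"
  proof
    fix x assume "x \<in> W"
    then obtain i where "i \<in> {1..m}" "x = \<sigma> (a + i)" by (auto simp: W_def)
    then show "x \<in> {1..n}" using permutes_in_image[OF \<sigma>, of "a + i"] am by auto
  qed
  obtain T :: "nat graph" and B where TB: "tree_decomposition ?G T B"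
    and bag: "\<And>t. t \<in> verts T \<Longrightarrow> card (B t) \<le> treewidth ?G + 1"
    using treewidth_attained[OF G] by metis
  have bag': "card (B t) \<le> k" if "t \<in> verts T" for t using bag[OF that] tw by simp
  have cW: "card W = m" unfolding W_def by (simp add: card_image injp)
  have Wv: "W \<subseteq> verts ?G" using Wn by (simp add: tangled_path_def)
  have \<tau>W: "\<tau> + k \<le> card W" "0 < \<tau>" using \<tau> cW tw by auto
  obtain A S where AS: "A \<subseteq> verts ?G" "S \<subseteq> verts ?G" "A \<inter> S = {}" "card S \<le> k"
    "\<tau> \<le> card (A \<inter> W)" "card (A \<inter> W) \<le> 2 * \<tau> + k"
    and sep: "\<And>u v. {u, v} \<in> edges ?G \<Longrightarrow> u \<in> A \<Longrightarrow> v \<in> A \<union> S"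
    using tree_decomposition_separation[OF TB G(1) bag' Wv \<tau>W] by metis
  have sep2: "u \<in> A \<longleftrightarrow> v \<in> A" if "{u, v} \<in> edges ?G" "u \<notin> S" "v \<notin> S" for u v
    using sep[of u v] sep[of v u] that by (auto simp: insert_commute)
  have finS: "finite S" using AS(2) by (rule finite_subset) (simp add: tangled_path_def)
  have rmono: "r x \<le> r y" if "x \<le> y" for x y
    unfolding r_def by (rule card_mono) (use finW that in auto)
  have rless: "r x < r y" if "x < y" "y \<in> W" for x y
  proof -
    have "{z \<in> W. z \<le> x} \<subset> {z \<in> W. z \<le> y}"     proof
      show "{z \<in> W. z \<le> x} \<subseteq> {z \<in> W. z \<le> y}" using that by auto
      have "y \<in> {z \<in> W. z \<le> y}" "y \<notin> {z \<in> W. z \<le> x}" using that by auto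
      then show "{z \<in> W. z \<le> x} \<noteq> {z \<in> W. z \<le> y}" by metis
    qed
    then show ?thesis unfolding r_def by (intro psubset_card_mono) (use finW in auto)
  qed
  have rinj: "inj_on r W" by (rule inj_onI) (metis rless linorder_neqE_nat less_irrefl)
  have r\<rho>: "r (?p i) = \<rho> i" if i: "i \<in> {1..m}" for i
  proof -
    have *: "?p j \<le> ?p i \<longleftrightarrow> \<rho> j \<le> \<rho> i" if "j \<in> {1..m}" for j
      using pat i that unfolding block_pattern_def by (metis linorder_not_less)
    have "{y \<in> W. y \<le> ?p i} = ?p ` {j \<in> {1..m}. \<rho> j \<le> \<rho> i}" using * by (auto simp: W_def)
    then have "r (?p i) = card {j \<in> {1..m}. \<rho> j \<le> \<rho> i}" unfolding r_def by (simp add: card_image injp)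
    also have "\<dots> = \<rho> i" by (rule permutes_rank[OF \<rho> i])
    finally show ?thesis .
  qed
  have rW: "r ` W = {1..m}"
  proof -
    have "r ` W = (\<lambda>i. r (?p i)) ` {1..m}" by (simp add: W_def image_image)
    also have "\<dots> = \<rho> ` {1..m}" by (rule image_cong[OF refl r\<rho>])
    finally show ?thesis using permutes_image[OF \<rho>] by simp
  qed
  define S' where "S' = r ` S \<inter> {1..m}"
  define A' where "A' = r ` (A \<inter> W) - S'"
  have notS: "w \<notin> S" if "w \<in> W" "r w \<notin> S'" for w
    using that rW by (auto simp: S'_def)
  have inA: "r w \<in> A' \<longleftrightarrow> w \<in> A" if "w \<in> W" "r w \<notin> S'" for w
    using that rinj by (auto simp: A'_def dest: inj_onD)
  have cS: "card S' \<le> k"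
  proof -
    have "card S' \<le> card (r ` S)" unfolding S'_def by (rule card_mono) (use finS in auto)
    also have "\<dots> \<le> card S" by (rule card_image_le[OF finS])
    finally show ?thesis using AS by simp
  qed
  have cAW: "card (r ` (A \<inter> W)) = card (A \<inter> W)"
    by (rule card_image) (rule inj_on_subset[OF rinj], simp)
  have finS': "finite S'" by (simp add: S'_def)
  have cA1: "s \<le> card A'"
    using diff_card_le_card_Diff[OF finS', of "r ` (A \<inter> W)"] cAW cS AS(5) \<tau> unfolding A'_def by linarith
  have cA2: "card A' + s \<le> m"
  proof -
    have "card A' \<le> card (r ` (A \<inter> W))" unfolding A'_def by (rule card_mono) (use finW in auto)
    then show ?thesis using cAW AS(6) \<tau> by linarith
  qed
  have "path_split m A' S'"
    unfolding path_split_def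
  proof (intro conjI ballI)
    show "A' \<subseteq> {1..m}" using rW by (auto simp: A'_def)
    show "S' \<subseteq> {1..m}" by (auto simp: S'_def)
    show "A' \<inter> S' = {}" by (auto simp: A'_def)
    fix i assume i: "i \<in> {1..<m}"
    show "i \<in> S' \<or> Suc i \<in> S' \<or> (i \<in> A' \<longleftrightarrow> Suc i \<in> A')"
    proof (cases "i \<in> S' \<or> Suc i \<in> S'")
      case False
      have "i \<in> r ` W" "Suc i \<in> r ` W" using i rW by auto
      then obtain w w' where w: "w \<in> W" "r w = i" "w' \<in> W" "r w' = Suc i" by auto
      have "w < w'"
      proof (rule ccontr)
        assume "\<not> w < w'"
        then have "r w' \<le> r w" by (intro rmono) simp
        then show False using w by simp
      qed
      have nS: "x \<notin> S" if "w \<le> x" "x < w'" for x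
      proof -
        have "r x = i" using rmono[OF that(1)] rless[OF that(2) w(3)] w by simp
        then show ?thesis using False i by (auto simp: S'_def)
      qed
      have nS': "w' \<notin> S" using notS[of w'] w False by auto
      have nS'': "x \<notin> S" if "w \<le> x" "x \<le> w'" for x
        using nS[of x] nS' that by (cases "x = w'") auto
      have "x \<in> A \<longleftrightarrow> w \<in> A" if "w \<le> x" "x \<le> w'" for x
        using that
      proof (induction x rule: dec_induct)
        case base show ?case by simp
      next
        case (step x)
        have "{x, x + 1} \<in> edges ?G"
          using step w(1,3) Wn unfolding tangled_path_def by fastforce
        then show ?case using step sep2[of x "x + 1"] nS''[of x] nS''[of "x + 1"] by simp
      qed
      from this[of w'] have "w' \<in> A \<longleftrightarrow> w \<in> A" using \<open>w < w'\<close> by simp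
      then show ?thesis using inA[of w] inA[of w'] w False by simp
    qed auto
  qed
  moreover have "\<rho> i \<in> S' \<or> \<rho> (Suc i) \<in> S' \<or> (\<rho> i \<in> A' \<longleftrightarrow> \<rho> (Suc i) \<in> A')" if i: "i \<in> {1..<m}" for i
  proof (cases "\<rho> i \<in> S' \<or> \<rho> (Suc i) \<in> S'")
    case False
    have I: "i \<in> {1..m}" "Suc i \<in> {1..m}" using i by auto
    have w: "?p i \<in> W" "?p (Suc i) \<in> W"
      unfolding W_def using imageI[OF I(1), of ?p] imageI[OF I(2), of ?p] by blast+
    have "{?p i, ?p (Suc i)} \<in> edges ?G"
      using i am unfolding tangled_path_def by (auto intro!: exI[of _ "a + i"])
    moreover have "?p i \<notin> S" "?p (Suc i) \<notin> S"
      using notS w r\<rho>[OF I(1)] r\<rho>[OF I(2)] False by auto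
    ultimately have "?p i \<in> A \<longleftrightarrow> ?p (Suc i) \<in> A" by (rule sep2)
    then show ?thesis using inA[OF w(1)] inA[OF w(2)] r\<rho>[OF I(1)] r\<rho>[OF I(2)] False by simp
  qed auto
  ultimately show ?thesis using cS cA1 cA2 unfolding separated_def by blast
qed

section \<open>Building a Mallows permutation one value at a time\<close>

abbreviation perms :: "nat \<Rightarrow> (nat \<Rightarrow> nat) set" where
  "perms n \<equiv> {\<sigma>. \<sigma> permutes {1..n}}"

text \<open>Earlier values from \<open>v\<close> upwards move up by one, which keeps the relative order of the earlier
  positions.\<close>

definition append_value :: "nat \<Rightarrow> nat \<Rightarrow> (nat \<Rightarrow> nat) \<Rightarrow> nat \<Rightarrow> nat" where
  "append_value n v \<sigma> i = (if i = Suc n then v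
     else if i \<in> {1..n} then (if v \<le> \<sigma> i then Suc (\<sigma> i) else \<sigma> i) else i)"

lemma append_value_less_iff:
  "i \<in> {1..n} \<Longrightarrow> j \<in> {1..n} \<Longrightarrow>
    append_value n v \<sigma> i < append_value n v \<sigma> j \<longleftrightarrow> \<sigma> i < \<sigma> j"
  by (auto simp: append_value_def)

lemma append_value_permutes:
  assumes \<sigma>: "\<sigma> permutes {1..n}" and v: "v \<in> {1..Suc n}"
  shows "append_value n v \<sigma> permutes {1..Suc n}"
proof (rule bij_imp_permutes)
  let ?f = "append_value n v \<sigma>"
  have \<sigma>n: "1 \<le> \<sigma> i \<and> \<sigma> i \<le> n" if "i \<in> {1..n}" for i
    using permutes_in_image[OF \<sigma>, of i] that by auto
  have inj: "inj_on ?f {1..Suc n}"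
  proof (rule linorder_inj_onI')
    fix i j assume ij: "i \<in> {1..Suc n}" "j \<in> {1..Suc n}" "i < j"
    show "?f i \<noteq> ?f j"
    proof (cases "j = Suc n")
      case True
      then show ?thesis using ij by (auto simp: append_value_def)
    next
      case False
      then have "i \<in> {1..n}" "j \<in> {1..n}" using ij by auto
      moreover have "\<sigma> i \<noteq> \<sigma> j" using permutes_inj[OF \<sigma>] ij(3) by (auto dest: injD)
      ultimately show ?thesis
        using append_value_less_iff[of i n j v \<sigma>] append_value_less_iff[of j n i v \<sigma>] by linarith
    qed
  qed
  have "?f ` {1..Suc n} \<subseteq> {1..Suc n}"
  proof (rule image_subsetI)
    fix i assume "i \<in> {1..Suc n}"
    then show "?f i \<in> {1..Suc n}"
      using \<sigma>n[of i] v by (cases "i = Suc n") (auto simp: append_value_def)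
  qed
  then show "bij_betw ?f {1..Suc n} {1..Suc n}"
    using inj by (simp add: bij_betw_def endo_inj_surj)
qed (auto simp: append_value_def)

lemma bij_betw_append_value:
  "bij_betw (\<lambda>(\<sigma>, v). append_value n v \<sigma>) (perms n \<times> {1..Suc n}) (perms (Suc n))"
proof -
  let ?f = "\<lambda>(\<sigma>, v). append_value n v \<sigma>"
  let ?A = "perms n \<times> {1..Suc n}"
  have inj: "inj_on ?f ?A"
  proof (rule inj_onI, safe)
    fix \<sigma> v \<sigma>' v' assume \<sigma>: "\<sigma> permutes {1..n}" "\<sigma>' permutes {1..n}"
      and eq: "append_value n v \<sigma> = append_value n v' \<sigma>'"
    show v: "v = v'" using fun_cong[OF eq, of "Suc n"] by (simp add: append_value_def)
    show "\<sigma> = \<sigma>'"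
    proof
      fix i
      show "\<sigma> i = \<sigma>' i"
      proof (cases "i \<in> {1..n}")
        case True
        then show ?thesis using fun_cong[OF eq, of i] v
          by (auto simp: append_value_def split: if_splits)
      next
        case False then show ?thesis using \<sigma> by (simp add: permutes_not_in)
      qed
    qed
  qed
  have sub: "?f ` ?A \<subseteq> perms (Suc n)" using append_value_permutes by auto
  have "card (?f ` ?A) = card (perms (Suc n))"
  proof -
    have "card (?f ` ?A) = card (perms n) * card {1..Suc n}"
      unfolding card_image[OF inj] by (rule card_cartesian_product)
    also have "card (perms n) = fact n" by (rule card_permutations) auto
    also have "fact n * card {1..Suc n} = fact (Suc n)" by simp
    also have "\<dots> = card (perms (Suc n))" by (rule card_permutations[symmetric]) auto
    finally show ?thesis .
  qed
  then have "?f ` ?A = perms (Suc n)"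
    using sub by (intro card_subset_eq) (simp_all add: finite_permutations)
  then show ?thesis using inj by (simp add: bij_betw_def)
qed

lemma inversion_number_append_value:
  assumes \<sigma>: "\<sigma> permutes {1..n}" and v: "v \<in> {1..Suc n}"
  shows "inversion_number (Suc n) (append_value n v \<sigma>) = inversion_number n \<sigma> + (Suc n - v)"
proof -
  let ?f = "append_value n v \<sigma>"
  let ?I = "\<lambda>n \<sigma>. {(i, j). i \<in> {1..n} \<and> j \<in> {1..n} \<and> i < j \<and> \<sigma> i > (\<sigma> j :: nat)}"
  let ?J = "(\<lambda>i. (i, Suc n)) ` {i \<in> {1..n}. v \<le> \<sigma> i}"
  have fin: "finite (?I n \<sigma>)" by (rule finite_subset[of _ "{1..n} \<times> {1..n}"]) auto
  have "?I (Suc n) ?f = ?I n \<sigma> \<union> ?J"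
  proof (intro set_eqI, clarify)
    fix i j
    consider "i \<in> {1..n}" "j \<in> {1..n}" | "i \<in> {1..n}" "j = Suc n" | "\<not> (i \<in> {1..n} \<and> j \<in> {1..Suc n})"
      by force
    then show "(i, j) \<in> ?I (Suc n) ?f \<longleftrightarrow> (i, j) \<in> ?I n \<sigma> \<union> ?J"
    proof cases
      case 1
      then show ?thesis using append_value_less_iff[OF 1(2,1), of v \<sigma>] by auto
    next
      case 2
      then show ?thesis by (auto simp: append_value_def)
    next
      case 3
      then show ?thesis by auto
    qed
  qed
  moreover have "card (?I n \<sigma> \<union> ?J) = card (?I n \<sigma>) + card ?J"
    by (rule card_Un_disjoint[OF fin]) auto
  moreover have "card ?J = card {i \<in> {1..n}. v \<le> \<sigma> i}" by (rule card_image) (auto simp: inj_on_def)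
  moreover have "card {i \<in> {1..n}. v \<le> \<sigma> i} = card (\<sigma> ` {i \<in> {1..n}. v \<le> \<sigma> i})"
    by (rule card_image[symmetric]) (rule permutes_inj_on[OF \<sigma>])
  moreover have "\<sigma> ` {i \<in> {1..n}. v \<le> \<sigma> i} = {v..n}"
  proof -
    have "\<sigma> ` {i \<in> {1..n}. v \<le> \<sigma> i} = \<sigma> ` {1..n} \<inter> {v..}" by auto
    then show ?thesis using v unfolding permutes_image[OF \<sigma>] by auto
  qed
  ultimately show ?thesis unfolding inversion_number_def by simp
qed

text \<open>The \<open>q\<close>-analogue of \<open>n\<close>; at \<open>Suc n\<close> it normalises the weights of the value appended to a permutation of
  length \<open>n\<close>.\<close>

definition q_number :: "nat \<Rightarrow> real \<Rightarrow> real" where "q_number n q = (\<Sum>k<n. q ^ k)"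

text \<open>The expectation of \<open>f\<close> under \<open>mallows n q\<close>, as a finite sum (see \<open>mallows_prob\<close>).\<close>

definition mallows_mean :: "nat \<Rightarrow> real \<Rightarrow> ((nat \<Rightarrow> nat) \<Rightarrow> real) \<Rightarrow> real" where
  "mallows_mean n q f = (\<Sum>\<sigma>\<in>perms n. q ^ inversion_number n \<sigma> * f \<sigma>) / mallows_Z n q"

abbreviation append_weight :: "nat \<Rightarrow> real \<Rightarrow> nat \<Rightarrow> real" where
  "append_weight n q v \<equiv> q ^ (Suc n - v) / q_number (Suc n) q"

lemma q_number_pos: "q > 0 \<Longrightarrow> n > 0 \<Longrightarrow> q_number n q > 0"
  unfolding q_number_def by (intro sum_pos) auto

lemma q_number_le:
  assumes "0 < q" "q < 1"
  shows "q_number n q \<le> 1 / (1 - q)"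
  unfolding q_number_def using assms by (simp add: sum_gp_strict divide_right_mono)

lemma mallows_Z_Suc: "mallows_Z (Suc n) q = mallows_Z n q * q_number (Suc n) q"
  unfolding mallows_Z_def q_number_def by simp

lemma mallows_Z_pos: "q > 0 \<Longrightarrow> mallows_Z n q > 0"
  unfolding mallows_Z_def by (intro prod_pos ballI q_number_pos[unfolded q_number_def]) auto

lemma sum_append_weight:
  assumes "q > 0"
  shows "(\<Sum>v=1..Suc n. append_weight n q v) = 1"
proof -
  have "(\<Sum>v=1..Suc n. q ^ (Suc n - v)) = q_number (Suc n) q"
    unfolding q_number_def
    by (rule sum.reindex_bij_witness[of _ "\<lambda>k. Suc n - k" "\<lambda>v. Suc n - v"]) auto
  then show ?thesis using q_number_pos[of q "Suc n"] assms by (simp flip: sum_divide_distrib)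
qed

text \<open>The appended value is independent of the permutation that it is appended to.\<close>

lemma mallows_mean_Suc:
  "mallows_mean (Suc n) q f =
     (\<Sum>v=1..Suc n. append_weight n q v * mallows_mean n q (\<lambda>\<sigma>. f (append_value n v \<sigma>)))"
proof -
  let ?w = "\<lambda>n \<sigma>. q ^ inversion_number n \<sigma>"
  have "(\<Sum>\<sigma>\<in>perms (Suc n). ?w (Suc n) \<sigma> * f \<sigma>) =
      (\<Sum>(\<sigma>, v)\<in>perms n \<times> {1..Suc n}. ?w (Suc n) (append_value n v \<sigma>) * f (append_value n v \<sigma>))"
    by (subst sum.reindex_bij_betw[OF bij_betw_append_value[of n], symmetric])
      (simp add: case_prod_unfold)
  also have "\<dots> = (\<Sum>(\<sigma>, v)\<in>perms n \<times> {1..Suc n}. q ^ (Suc n - v) * (?w n \<sigma> * f (append_value n v \<sigma>)))"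
  proof (rule sum.cong[OF refl], clarify)
    fix \<sigma> v assume "\<sigma> permutes {1..n}" "v \<in> {1..Suc n}"
    then show "?w (Suc n) (append_value n v \<sigma>) * f (append_value n v \<sigma>) =
        q ^ (Suc n - v) * (?w n \<sigma> * f (append_value n v \<sigma>))"
      by (simp only: inversion_number_append_value power_add mult_ac)
  qed
  also have "\<dots> = (\<Sum>v=1..Suc n. \<Sum>\<sigma>\<in>perms n. q ^ (Suc n - v) * (?w n \<sigma> * f (append_value n v \<sigma>)))"
    by (subst sum.cartesian_product[symmetric]) (rule sum.swap)
  also have "\<dots> = (\<Sum>v=1..Suc n. q ^ (Suc n - v) * (\<Sum>\<sigma>\<in>perms n. ?w n \<sigma> * f (append_value n v \<sigma>)))"
    by (simp only: sum_distrib_left)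
  finally have "mallows_mean (Suc n) q f = (\<Sum>v=1..Suc n. q ^ (Suc n - v) *
      (\<Sum>\<sigma>\<in>perms n. ?w n \<sigma> * f (append_value n v \<sigma>))) / (mallows_Z n q * q_number (Suc n) q)"
    unfolding mallows_mean_def mallows_Z_Suc by (rule arg_cong)
  also have "\<dots> = (\<Sum>v=1..Suc n. append_weight n q v * mallows_mean n q (\<lambda>\<sigma>. f (append_value n v \<sigma>)))"
    unfolding sum_divide_distrib[of _ "{1..Suc n}"] mallows_mean_def
    by (rule sum.cong) (simp_all only: times_divide_times_eq mult.commute)
  finally show ?thesis .
qed

lemma mallows_mean_0: "mallows_mean 0 q f = f id"
  by (simp add: mallows_mean_def mallows_Z_def inversion_number_def)

lemma mallows_mean_cmult: "mallows_mean n q (\<lambda>\<sigma>. c * f \<sigma>) = c * mallows_mean n q f"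
  by (simp add: mallows_mean_def sum_distrib_left mult_ac)

lemma mallows_mean_add: "mallows_mean n q (\<lambda>\<sigma>. f \<sigma> + g \<sigma>) = mallows_mean n q f + mallows_mean n q g"
  by (simp add: mallows_mean_def distrib_left sum.distrib add_divide_distrib)

lemma mallows_mean_sum:
  "mallows_mean n q (\<lambda>\<sigma>. \<Sum>i\<in>I. f i \<sigma>) = (\<Sum>i\<in>I. mallows_mean n q (f i))"
  unfolding mallows_mean_def by (simp add: sum_distrib_left sum.swap[of _ I] sum_divide_distrib)

lemma mallows_mean_mono:
  assumes "q > 0" "\<And>\<sigma>. \<sigma> permutes {1..n} \<Longrightarrow> f \<sigma> \<le> g \<sigma>"
  shows "mallows_mean n q f \<le> mallows_mean n q g"
  unfolding mallows_mean_def
  by (intro divide_right_mono sum_mono mult_left_mono) (use assms mallows_Z_pos[of q n] in auto)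

lemma mallows_mean_nonneg:
  assumes "q > 0" "\<And>\<sigma>. 0 \<le> f \<sigma>"
  shows "0 \<le> mallows_mean n q f"
  unfolding mallows_mean_def
  by (intro divide_nonneg_pos sum_nonneg mult_nonneg_nonneg mallows_Z_pos) (use assms in auto)

lemma mallows_mean_cong:
  assumes "\<And>\<sigma>. \<sigma> permutes {1..n} \<Longrightarrow> f \<sigma> = g \<sigma>"
  shows "mallows_mean n q f = mallows_mean n q g"
  unfolding mallows_mean_def using assms by (intro arg_cong2[of _ _ _ _ "(/)"] sum.cong) auto

lemma mallows_mean_append_invariant:
  assumes "q > 0" "N \<le> n"
    and "\<And>k v \<sigma>. N \<le> k \<Longrightarrow> \<sigma> permutes {1..k} \<Longrightarrow> v \<in> {1..Suc k} \<Longrightarrow> f (append_value k v \<sigma>) = f \<sigma>"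
  shows "mallows_mean n q f = mallows_mean N q f"
  using assms(2)
proof (induction n rule: dec_induct)
  case (step n)
  have "mallows_mean (Suc n) q f = (\<Sum>v=1..Suc n. append_weight n q v * mallows_mean n q f)"
    unfolding mallows_mean_Suc
    by (intro sum.cong refl arg_cong2[of _ _ _ _ "(*)"] mallows_mean_cong assms(3)) (use step in auto)
  also have "\<dots> = mallows_mean n q f"
    using sum_append_weight[OF assms(1), of n] by (simp only: sum_distrib_right[symmetric] mult_1)
  finally show ?case using step by simp
qed simp

lemma mallows_mean_const:
  assumes "q > 0" shows "mallows_mean n q (\<lambda>_. c) = c"
  using mallows_mean_append_invariant[OF assms, of 0 n "\<lambda>_. c"] by (simp add: mallows_mean_0)

lemma mallows_prob:
  assumes "q > 0"
  shows "\<P>(\<sigma> in mallows n q. E \<sigma>) = mallows_mean n q (\<lambda>\<sigma>. of_bool (E \<sigma>))"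
proof -
  let ?p = "\<lambda>\<sigma>. q ^ inversion_number n \<sigma> / mallows_Z n q"
  let ?X = "{\<sigma> \<in> perms n. E \<sigma>}"
  have fin: "finite (perms n)" by (simp add: finite_permutations)
  have pos: "0 \<le> ?p \<sigma>" for \<sigma> using assms mallows_Z_pos[OF assms, of n] by simp
  have "emeasure (mallows n q) ?X = (\<Sum>\<sigma>\<in>?X. ennreal (?p \<sigma>))"
    unfolding mallows_def by (rule emeasure_point_measure_finite[OF fin]) auto
  also have "\<dots> = ennreal (\<Sum>\<sigma>\<in>?X. ?p \<sigma>)" by (rule sum_ennreal) (rule pos)
  finally have "measure (mallows n q) ?X = (\<Sum>\<sigma>\<in>?X. ?p \<sigma>)"
    unfolding measure_def using pos by (simp add: sum_nonneg)
  also have "\<dots> = mallows_mean n q (\<lambda>\<sigma>. of_bool (E \<sigma>))"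
    unfolding mallows_mean_def sum_divide_distrib
    using fin by (subst sum.inter_filter) (auto intro!: sum.cong)
  finally show ?thesis by (simp add: mallows_def space_point_measure)
qed

section \<open>The number of late low values\<close>

lemma late_low_append_value:
  assumes "x \<le> n" "v \<in> {1..Suc n}"
  shows "late_low (Suc n) x y (append_value n v \<sigma>) =
    (if v \<le> y then Suc (late_low n x (y - 1) \<sigma>) else late_low n x y \<sigma>)"
proof (cases "v \<le> y")
  case True
  have "{i \<in> {x<..Suc n}. append_value n v \<sigma> i \<le> y} = insert (Suc n) {i \<in> {x<..n}. \<sigma> i \<le> y - 1}"
    using True assms by (auto simp: append_value_def split: if_splits)
  then show ?thesis using True unfolding late_low_def by simp
next
  case False
  have "{i \<in> {x<..Suc n}. append_value n v \<sigma> i \<le> y} = {i \<in> {x<..n}. \<sigma> i \<le> y}"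
    using False assms by (auto simp: append_value_def split: if_splits)
  then show ?thesis using False unfolding late_low_def by simp
qed

lemma late_low_le: "late_low n x y \<sigma> \<le> n - x"
proof -
  have "late_low n x y \<sigma> \<le> card {x<..n}" unfolding late_low_def by (rule card_mono) auto
  then show ?thesis by simp
qed

lemma sum_append_weight_low:
  assumes "0 < q" "q < 1" "y \<le> Suc n"
  shows "(\<Sum>v=1..y. append_weight n q v) \<le> q ^ (Suc n - y)"
proof -
  have "(\<Sum>v=1..y. q ^ (Suc n - v)) = (\<Sum>j<y. q ^ (Suc n - y) * q ^ j)"
    by (rule sum.reindex_bij_witness[of _ "\<lambda>j. y - j" "\<lambda>v. y - v"])
      (use assms in \<open>auto simp flip: power_add\<close>)
  also have "\<dots> = q ^ (Suc n - y) * q_number y q" unfolding q_number_def by (simp add: sum_distrib_left)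
  also have "\<dots> \<le> q ^ (Suc n - y) * q_number (Suc n) q"
    unfolding q_number_def by (intro mult_left_mono sum_mono2) (use assms in auto)
  finally show ?thesis using q_number_pos[of q "Suc n"] assms
    by (simp add: divide_le_eq flip: sum_divide_distrib)
qed

text \<open>Induction along the chain that strips off the last positions. In terms of \<open>r = n - y\<close>, the number of
  values above \<open>y\<close>, a step that removes a value at most \<open>y\<close> has probability at most \<open>q ^ r\<close>, gains a factor
  \<open>z\<close> and keeps \<open>r\<close>; otherwise \<open>r\<close> drops by one. Summing over the number of stays at level \<open>r\<close> gives the
  geometric series \<open>1 / (1 - z * q ^ r)\<close>. At the end \<open>r\<close> is \<open>x - y\<close> plus the number of stays, so the condition
  \<open>y + d \<le> x + late_low n x y \<sigma>\<close> says that the chain never falls below \<open>d\<close>; this is why the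
  product starts at \<open>d\<close>.\<close>

lemma mallows_mean_late_low:
  assumes q: "0 < q" "q < 1" and z: "0 \<le> z" "z * q ^ d < 1" and d: "1 \<le> d"
    and "x \<le> n" "y \<le> n" "d \<le> n - y"
  shows "mallows_mean n q (\<lambda>\<sigma>. if y + d \<le> x + late_low n x y \<sigma> then z ^ late_low n x y \<sigma> else 0)
     \<le> (\<Prod>r=d..n - y. 1 / (1 - z * q ^ r))"
  using assms(6-8)
proof (induction n arbitrary: y rule: dec_induct)
  case base
  have *: "late_low x x y \<sigma> = 0" for \<sigma> by (simp add: late_low_def)
  have "z * q ^ r < 1" if "d \<le> r" for r
    using power_decreasing[OF that, of q] q z mult_left_mono[of "q ^ r" "q ^ d" z] by auto
  then have "1 \<le> (\<Prod>r=d..x - y. 1 / (1 - z * q ^ r))"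
    by (intro prod_ge_1) (use z q in \<open>auto simp: divide_simps\<close>)
  moreover have "mallows_mean x q (\<lambda>\<sigma>. if y + d \<le> x + 0 then z ^ 0 else 0) \<le> 1"
    using mallows_mean_const[OF q(1), of x "if y + d \<le> x + 0 then z ^ 0 else 0"] by simp
  ultimately show ?case unfolding * by (rule order_trans[rotated])
next
  case (step n)
  let ?F = "\<lambda>n y \<sigma>. if y + d \<le> x + late_low n x y \<sigma> then z ^ late_low n x y \<sigma> else 0"
  let ?B = "\<lambda>r. \<Prod>r=d..r. 1 / (1 - z * q ^ r)"
  let ?r = "Suc n - y"
  have zq: "z * q ^ r < 1" if "d \<le> r" for r
    using power_decreasing[OF that, of q] q z mult_left_mono[of "q ^ r" "q ^ d" z] by auto
  have B0: "0 \<le> ?B r" for r by (intro prod_nonneg) (use zq in \<open>auto simp: less_imp_le\<close>)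
  have yn: "y \<le> n" using step.prems d by linarith
  let ?low = "z * ?B ?r" and ?high = "?B ?r * (1 - z * q ^ ?r)"
  have high0: "0 \<le> ?high" using B0 zq[of ?r] step.prems by simp
  have bound: "mallows_mean n q (\<lambda>\<sigma>. ?F (Suc n) y (append_value n v \<sigma>)) \<le> (if v \<le> y then ?low else ?high)"
    if v: "v \<in> {1..Suc n}" for v
  proof (cases "v \<le> y")
    case True
    have "mallows_mean n q (\<lambda>\<sigma>. ?F (Suc n) y (append_value n v \<sigma>)) = mallows_mean n q (\<lambda>\<sigma>. z * ?F n (y - 1) \<sigma>)"
      using True v by (intro mallows_mean_cong) (auto simp: late_low_append_value[OF step(1) v])
    also have "\<dots> = z * mallows_mean n q (?F n (y - 1))" by (rule mallows_mean_cmult)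
    also have "\<dots> \<le> z * ?B (n - (y - 1))"
      by (intro mult_left_mono step.IH z) (use yn step.prems True v in auto)
    also have "n - (y - 1) = ?r" using True v yn by auto
    finally show ?thesis using True by simp
  next
    case False
    have eq: "mallows_mean n q (\<lambda>\<sigma>. ?F (Suc n) y (append_value n v \<sigma>)) = mallows_mean n q (?F n y)"
      using False by (intro mallows_mean_cong) (auto simp: late_low_append_value[OF step(1) v])
    show ?thesis
    proof (cases "d \<le> n - y")
      case True
      have "mallows_mean n q (?F n y) \<le> ?B (n - y)" by (rule step.IH) (use yn True in auto)
      also have "?B (n - y) = ?high"
      proof -
        have "?r = Suc (n - y)" "d \<le> Suc (n - y)" using yn True by auto
        then show ?thesis using zq[of ?r] by simp
      qed
      finally show ?thesis using eq False by simp
    next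
      case small: False
      have "?F n y \<sigma> = 0" for \<sigma> using late_low_le[of n x y \<sigma>] small yn step(1) by auto
      then show ?thesis using eq False high0 mallows_mean_const[OF q(1), of n 0] by simp
    qed
  qed
  let ?w = "append_weight n q"
  have w0: "0 \<le> ?w v" for v using q q_number_pos[of q "Suc n"] by simp
  have "mallows_mean (Suc n) q (?F (Suc n) y) \<le> (\<Sum>v=1..Suc n. ?w v * (if v \<le> y then ?low else ?high))"
    unfolding mallows_mean_Suc by (intro sum_mono mult_left_mono bound w0) auto
  also have "\<dots> = (\<Sum>v=1..y. ?w v) * ?low + (\<Sum>v=Suc y..Suc n. ?w v) * ?high"
  proof -
    have "{1..Suc n} = {1..y} \<union> {Suc y..Suc n}" using yn by auto
    then have "(\<Sum>v=1..Suc n. ?w v * (if v \<le> y then ?low else ?high)) =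
        (\<Sum>v=1..y. ?w v * (if v \<le> y then ?low else ?high)) + (\<Sum>v=Suc y..Suc n. ?w v * (if v \<le> y then ?low else ?high))"
      by (simp only: sum.union_disjoint finite_atLeastAtMost) (rule sum.union_disjoint, auto)
    also have "\<dots> = (\<Sum>v=1..y. ?w v * ?low) + (\<Sum>v=Suc y..Suc n. ?w v * ?high)"
      by (intro arg_cong2[of _ _ _ _ "(+)"] sum.cong) auto
    finally show ?thesis by (simp only: sum_distrib_right)
  qed
  also have "\<dots> \<le> q ^ ?r * ?low + 1 * ?high"
  proof (intro add_mono mult_right_mono)
    show "(\<Sum>v=1..y. ?w v) \<le> q ^ ?r" by (rule sum_append_weight_low[OF q]) (use yn in simp)
    have "(\<Sum>v=Suc y..Suc n. ?w v) \<le> (\<Sum>v=1..Suc n. ?w v)" by (rule sum_mono2) (use w0 in auto)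
    then show "(\<Sum>v=Suc y..Suc n. ?w v) \<le> 1" using sum_append_weight[OF q(1), of n] by simp
  qed (use z B0 high0 in auto)
  also have "\<dots> = ?B ?r" by (simp add: algebra_simps)
  finally show ?case .
qed

text \<open>With \<open>s\<close> and \<open>s'\<close> the square roots of \<open>1 - q ^ N\<close> and \<open>1 - q ^ Suc N\<close>, the factor
  \<open>1 / s'\<^sup>2\<close> is at most \<open>exp (4 / (1 - q) * (s' - s))\<close>, since
  \<open>(s' - s) * (s' + s) = q ^ N * (1 - q)\<close>; the exponents telescope.\<close>

lemma euler_product_le:
  fixes q :: real
  assumes q: "0 < q" "q < 1"
  shows "(\<Prod>j=1..N. 1 / (1 - q ^ j)) \<le> exp (4 / (1 - q) * sqrt (1 - q ^ N))"
proof (induction N)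
  case (Suc N)
  define s s' where "s = sqrt (1 - q ^ N)" and "s' = sqrt (1 - q ^ Suc N)"
  have lt: "q ^ Suc N < 1" using q by (intro power_Suc_less_one) auto
  have s': "0 < s'" "s' \<le> 1" "s'\<^sup>2 = 1 - q ^ Suc N"
    using lt q by (auto simp: s'_def real_sqrt_le_1_iff simp del: power_Suc)
  have s: "0 \<le> s" "s\<^sup>2 = 1 - q ^ N" using q by (auto simp: s_def power_le_one)
  have ss: "s \<le> s'" unfolding s_def s'_def using q by (simp add: mult_left_le_one_le)
  have "(s' - s) * (s' + s) = q ^ N * (1 - q)"
    using s s' by (simp add: algebra_simps power2_eq_square)
  moreover have "(s' - s) * (s' + s) \<le> (s' - s) * (2 * s')" using ss by (intro mult_left_mono) auto
  ultimately have 1: "q ^ N * (1 - q) \<le> (s' - s) * (2 * s')" by simp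
  have "ln (1 / s') \<le> 1 / s' - 1" using s' by (intro ln_le_minus_one) auto
  also have "\<dots> = (1 - s') / s'" using s' by (simp add: field_simps)
  also have "\<dots> \<le> (1 - s'\<^sup>2) / s'"
    using s'(1,2) by (intro divide_right_mono) (auto simp: power2_eq_square mult_left_le)
  also have "\<dots> \<le> q ^ N / s'"
    using s' q by (intro divide_right_mono) (auto simp: mult_left_le_one_le)
  also have "\<dots> \<le> 2 / (1 - q) * (s' - s)" using 1 s' q by (simp add: field_simps)
  finally have "2 * ln (1 / s') \<le> 2 * (2 / (1 - q) * (s' - s))" by (rule mult_left_mono) simp
  then have 2: "2 * ln (1 / s') \<le> 4 / (1 - q) * (s' - s)" by simp
  have "1 / (1 - q ^ Suc N) = (1 / s')\<^sup>2" using s' by (simp add: power_divide del: power_Suc)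
  also have "\<dots> = exp (2 * ln (1 / s'))" using s' by (simp add: exp_double del: ln_div)
  also have "\<dots> \<le> exp (4 / (1 - q) * (s' - s))" using 2 by simp
  finally have "1 / (1 - q ^ Suc N) \<le> exp (4 / (1 - q) * (s' - s))" .
  then have "(\<Prod>j=1..N. 1 / (1 - q ^ j)) * (1 / (1 - q ^ Suc N))
      \<le> exp (4 / (1 - q) * s) * exp (4 / (1 - q) * (s' - s))"
    using Suc lt unfolding s_def by (intro mult_mono) (auto simp del: power_Suc)
  also have "\<dots> = exp (4 / (1 - q) * s')"
    by (simp only: exp_add[symmetric] distrib_left[symmetric] add.commute[of s] diff_add_cancel)
  finally show ?case by (simp add: s'_def)
qed simp

text \<open>Markov's inequality for \<open>z ^ late_low n x x \<sigma>\<close> with \<open>z = (1 / q) ^ (d - 1)\<close>, the largest power for which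
  the product from level \<open>d\<close> onwards stays finite.\<close>

lemma mallows_late_low_tail:
  assumes q: "0 < q" "q < 1" and d: "1 \<le> d" and x: "x \<le> n"
  shows "mallows_mean n q (\<lambda>\<sigma>. of_bool (d \<le> late_low n x x \<sigma>)) \<le> q ^ (d * (d - 1)) * exp (4 / (1 - q))"
proof (cases "d \<le> n - x")
  case False
  then have *: "(of_bool (d \<le> late_low n x x \<sigma>) :: real) = 0" for \<sigma> using late_low_le[of n x x \<sigma>] by auto
  have "mallows_mean n q (\<lambda>\<sigma>. of_bool (d \<le> late_low n x x \<sigma>)) = 0"
    unfolding * by (rule mallows_mean_const[OF q(1)])
  then show ?thesis using q by simp
next
  case True
  define z where "z = (1 / q) ^ (d - 1)"
  have z1: "1 \<le> z" unfolding z_def using q by (intro one_le_power) auto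
  have zr: "z * q ^ r = q ^ (r - (d - 1))" if "d \<le> r" for r
    using that q power_add[of q "r - (d - 1)" "d - 1"] by (simp add: z_def power_one_over)
  let ?f = "\<lambda>\<sigma>. if x + d \<le> x + late_low n x x \<sigma> then z ^ late_low n x x \<sigma> else 0"
  have "z ^ d * mallows_mean n q (\<lambda>\<sigma>. of_bool (d \<le> late_low n x x \<sigma>)) \<le> mallows_mean n q ?f"
    unfolding mallows_mean_cmult[symmetric]
    by (rule mallows_mean_mono[OF q(1)]) (auto intro: power_increasing z1)
  also have "\<dots> \<le> (\<Prod>r=d..n - x. 1 / (1 - z * q ^ r))"
    by (rule mallows_mean_late_low) (use q z1 d x True zr[of d] in auto)
  also have "\<dots> = (\<Prod>j=1..n - x - (d - 1). 1 / (1 - q ^ j))"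
    by (rule prod.reindex_bij_witness[of _ "\<lambda>j. j + (d - 1)" "\<lambda>r. r - (d - 1)"]) (use d zr in auto)
  also have "\<dots> \<le> exp (4 / (1 - q) * sqrt (1 - q ^ (n - x - (d - 1))))" by (rule euler_product_le[OF q])
  also have "\<dots> \<le> exp (4 / (1 - q))"
    using q by (simp add: mult_left_le divide_right_mono real_sqrt_le_1_iff)
  finally have "z ^ d * mallows_mean n q (\<lambda>\<sigma>. of_bool (d \<le> late_low n x x \<sigma>)) \<le> exp (4 / (1 - q))" .
  moreover have "z ^ d = 1 / q ^ (d * (d - 1))"
    unfolding z_def by (simp add: power_one_over mult.commute flip: power_mult)
  ultimately show ?thesis using q by (simp add: field_simps)
qed

section \<open>Patterns of blocks of positions\<close>

lemma block_pattern_append_value: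
  assumes "a + m \<le> n"
  shows "block_pattern a m (append_value n v \<sigma>) \<rho> \<longleftrightarrow> block_pattern a m \<sigma> \<rho>"
proof -
  have "append_value n v \<sigma> (a + i) < append_value n v \<sigma> (a + j) \<longleftrightarrow> \<sigma> (a + i) < \<sigma> (a + j)"
    if "i \<in> {1..m}" "j \<in> {1..m}" for i j
    by (rule append_value_less_iff) (use that assms in auto)
  then show ?thesis unfolding block_pattern_def by auto
qed

text \<open>The \<open>i\<close>-th factor of the normalising constant has \<open>i\<close> terms, none of them below \<open>q ^ m\<close>.\<close>

lemma mallows_Z_ge:
  assumes "0 < q" "q \<le> 1"
  shows "fact m * q ^ (m * m) \<le> mallows_Z m q"
proof -
  have "fact m * q ^ (m * m) = (\<Prod>i=1..m. real i * q ^ m)"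
    by (simp add: prod.distrib fact_prod power_mult)
  also have "\<dots> \<le> (\<Prod>i=1..m. \<Sum>k<i. q ^ k)"
  proof (rule prod_mono, intro conjI)
    fix i assume i: "i \<in> {1..m}"
    show "0 \<le> real i * q ^ m" using assms by simp
    have "real (card {..<i}) * q ^ m \<le> (\<Sum>k<i. q ^ k)"
      by (rule sum_bounded_below) (use assms i in \<open>auto intro: power_decreasing\<close>)
    then show "real i * q ^ m \<le> (\<Sum>k<i. q ^ k)" by simp
  qed
  finally show ?thesis by (simp add: mallows_Z_def)
qed

text \<open>Appending values does not change the relative order of the first \<open>m\<close> positions, so the pattern
  of the first block is itself Mallows distributed with length \<open>m\<close>.\<close>

lemma mallows_first_block:
  assumes q: "0 < q" "q \<le> 1" and "m \<le> n" and R: "R \<subseteq> perms m"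
  shows "mallows_mean n q (\<lambda>\<sigma>. of_bool (\<not> (\<exists>\<rho>\<in>perms m - R. block_pattern 0 m \<sigma> \<rho>)))
    \<le> card R / (fact m * q ^ (m * m))"
proof -
  let ?E = "\<lambda>\<sigma>. \<not> (\<exists>\<rho>\<in>perms m - R. block_pattern 0 m \<sigma> \<rho>)"
  have "mallows_mean n q (\<lambda>\<sigma>. of_bool (?E \<sigma>)) = mallows_mean m q (\<lambda>\<sigma>. of_bool (?E \<sigma>))"
    by (rule mallows_mean_append_invariant) (use q assms(3) in \<open>simp_all add: block_pattern_append_value\<close>)
  also have "\<dots> \<le> (\<Sum>\<sigma>\<in>R. q ^ inversion_number m \<sigma>) / mallows_Z m q"
    unfolding mallows_mean_def
  proof (rule divide_right_mono)
    have "(\<Sum>\<sigma>\<in>perms m. q ^ inversion_number m \<sigma> * of_bool (?E \<sigma>))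
        \<le> (\<Sum>\<sigma>\<in>perms m. if \<sigma> \<in> R then q ^ inversion_number m \<sigma> else 0)"
    proof (rule sum_mono)
      fix \<sigma> assume "\<sigma> \<in> perms m"
      moreover have "block_pattern 0 m \<sigma> \<sigma>" by (simp add: block_pattern_def)
      ultimately have "\<sigma> \<in> R" if "?E \<sigma>" using that by blast
      then show "q ^ inversion_number m \<sigma> * of_bool (?E \<sigma>) \<le> (if \<sigma> \<in> R then q ^ inversion_number m \<sigma> else 0)"
        using q by (cases "?E \<sigma>") auto
    qed
    also have "\<dots> = (\<Sum>\<sigma>\<in>R. q ^ inversion_number m \<sigma>)"
      using R by (simp add: sum.inter_restrict[symmetric] finite_permutations Int_absorb1)
    finally show "(\<Sum>\<sigma>\<in>perms m. q ^ inversion_number m \<sigma> * of_bool (?E \<sigma>)) \<le> (\<Sum>\<sigma>\<in>R. q ^ inversion_number m \<sigma>)" .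
    show "0 \<le> mallows_Z m q" using mallows_Z_pos[of q m] q by simp
  qed
  also have "\<dots> \<le> (\<Sum>\<sigma>\<in>R. 1) / mallows_Z m q"
    using q mallows_Z_pos[of q m] by (intro divide_right_mono sum_mono) (auto intro: power_le_one)
  also have "\<dots> \<le> card R / (fact m * q ^ (m * m))"
    using mallows_Z_ge[OF q, of m] q by (simp add: divide_left_mono mallows_Z_pos)
  finally show ?thesis .
qed

text \<open>The block after position \<open>a\<close>, as far as position \<open>a + j\<close>, consists of the \<open>j\<close> largest
  values so far, in the relative order given by the first \<open>j\<close> values of \<open>\<pi>\<close>.\<close>

definition top_block :: "nat \<Rightarrow> nat \<Rightarrow> (nat \<Rightarrow> nat) \<Rightarrow> (nat \<Rightarrow> nat) \<Rightarrow> bool" where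
  "top_block a j \<sigma> \<pi> \<longleftrightarrow> (\<forall>i\<in>{1..j}. \<sigma> (a + i) = a + card {i' \<in> {1..j}. \<pi> i' \<le> \<pi> i})"

lemma card_rank_less:
  fixes \<pi> :: "nat \<Rightarrow> nat"
  assumes "\<pi> i < \<pi> j" "j \<in> {1..k}"
  shows "card {i' \<in> {1..k}. \<pi> i' \<le> \<pi> i} < card {i' \<in> {1..k}. \<pi> i' \<le> \<pi> j}"
proof (rule psubset_card_mono)
  have "j \<in> {i' \<in> {1..k}. \<pi> i' \<le> \<pi> j}" "j \<notin> {i' \<in> {1..k}. \<pi> i' \<le> \<pi> i}" using assms by auto
  moreover have "{i' \<in> {1..k}. \<pi> i' \<le> \<pi> i} \<subseteq> {i' \<in> {1..k}. \<pi> i' \<le> \<pi> j}" using assms by auto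
  ultimately show "{i' \<in> {1..k}. \<pi> i' \<le> \<pi> i} \<subset> {i' \<in> {1..k}. \<pi> i' \<le> \<pi> j}" by blast
qed simp

lemma top_block_block_pattern:
  assumes "top_block a m \<sigma> \<pi>"
  shows "block_pattern a m \<sigma> \<pi>"
  unfolding block_pattern_def
proof (intro ballI)
  fix i j assume ij: "i \<in> {1..m}" "j \<in> {1..m}"
  let ?R = "\<lambda>i. {i' \<in> {1..m}. \<pi> i' \<le> \<pi> i}"
  have "card (?R i) < card (?R j) \<longleftrightarrow> \<pi> i < \<pi> j"
  proof
    assume "\<pi> i < \<pi> j"
    then show "card (?R i) < card (?R j)" using ij(2) by (rule card_rank_less)
  next
    assume less: "card (?R i) < card (?R j)"
    show "\<pi> i < \<pi> j"
    proof (rule ccontr)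
      assume "\<not> \<pi> i < \<pi> j"
      then have "card (?R j) \<le> card (?R i)" by (intro card_mono) auto
      then show False using less by simp
    qed
  qed
  then show "\<sigma> (a + i) < \<sigma> (a + j) \<longleftrightarrow> \<pi> i < \<pi> j"
    using assms ij unfolding top_block_def by simp
qed

text \<open>The appended value is placed among the top values of the block as \<open>\<pi> (Suc j)\<close> is placed among
  the first \<open>Suc j\<close> values of \<open>\<pi>\<close>.\<close>

lemma top_block_append_value:
  assumes \<pi>: "\<pi> permutes {1..m}" and top: "top_block a j \<sigma> \<pi>"
  shows "top_block a (Suc j) (append_value (a + j) (a + card {i' \<in> {1..Suc j}. \<pi> i' \<le> \<pi> (Suc j)}) \<sigma>) \<pi>"
proof -
  let ?R = "\<lambda>k i. {i' \<in> {1..k}. \<pi> i' \<le> \<pi> i}"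
  let ?v = "a + card (?R (Suc j) (Suc j))"
  have ins: "?R (Suc j) i = (if \<pi> (Suc j) \<le> \<pi> i then insert (Suc j) (?R j i) else ?R j i)" for i
    by (auto simp: le_Suc_eq)
  have c: "card (?R (Suc j) i) = card (?R j i) + (if \<pi> (Suc j) \<le> \<pi> i then 1 else 0)" for i
    unfolding ins by simp
  have "append_value (a + j) ?v \<sigma> (a + i) = a + card (?R (Suc j) i)" if i: "i \<in> {1..Suc j}" for i
  proof (cases "i = Suc j")
    case True then show ?thesis by (simp add: append_value_def)
  next
    case False
    then have i: "i \<in> {1..j}" using i by auto
    have \<sigma>: "\<sigma> (a + i) = a + card (?R j i)" using top i unfolding top_block_def by auto
    have ne: "\<pi> i \<noteq> \<pi> (Suc j)"
    proof
      assume "\<pi> i = \<pi> (Suc j)"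
      then have "i = Suc j" by (rule injD[OF permutes_inj[OF \<pi>]])
      then show False using i by simp
    qed
    have "?v \<le> \<sigma> (a + i) \<longleftrightarrow> \<pi> (Suc j) \<le> \<pi> i"
    proof
      assume le: "\<pi> (Suc j) \<le> \<pi> i"
      then have "card (?R j (Suc j)) < card (?R j i)" using i ne by (intro card_rank_less) auto
      then show "?v \<le> \<sigma> (a + i)" unfolding \<sigma> c by simp
    next
      assume v: "?v \<le> \<sigma> (a + i)"
      show "\<pi> (Suc j) \<le> \<pi> i"
      proof (rule ccontr)
        assume "\<not> \<pi> (Suc j) \<le> \<pi> i"
        then have "card (?R j i) \<le> card (?R j (Suc j))" by (intro card_mono) auto
        then show False using v unfolding \<sigma> c by simp
      qed
    qed
    then show ?thesis using i \<sigma> c[of i] by (auto simp: append_value_def)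
  qed
  then show ?thesis unfolding top_block_def by blast
qed

definition no_block :: "nat \<Rightarrow> nat \<Rightarrow> (nat \<Rightarrow> nat) \<Rightarrow> (nat \<Rightarrow> nat) \<Rightarrow> bool" where
  "no_block m K \<pi> \<sigma> \<longleftrightarrow> (\<forall>k<K. \<not> block_pattern (k * m) m \<sigma> \<pi>)"

lemma no_block_append_value:
  assumes "K * m \<le> n"
  shows "no_block m K \<pi> (append_value n v \<sigma>) \<longleftrightarrow> no_block m K \<pi> \<sigma>"
proof -
  have "k * m + m \<le> n" if "k < K" for k
  proof -
    have "Suc k * m \<le> K * m" using that by (intro mult_le_mono1) simp
    then show ?thesis using assms by simp
  qed
  then show ?thesis unfolding no_block_def using block_pattern_append_value by auto
qed

text \<open>Whatever the permutation of length \<open>K * m\<close> is, the next \<open>m\<close> values can be chosen so that they form the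
  pattern \<open>\<pi>\<close> on top of all others. Each of these values has fewer than \<open>m\<close> others above it, so its
  probability is at least \<open>(1 - q) * q ^ m\<close>.\<close>

lemma mallows_no_block:
  assumes q: "0 < q" "q < 1" and \<pi>: "\<pi> permutes {1..m}" and "K * m \<le> n"
  shows "mallows_mean n q (\<lambda>\<sigma>. of_bool (no_block m K \<pi> \<sigma>)) \<le> (1 - ((1 - q) * q ^ m) ^ m) ^ K"
proof -
  define c where "c = (1 - q) * q ^ m"
  let ?N = "\<lambda>n K. mallows_mean n q (\<lambda>\<sigma>. of_bool (no_block m K \<pi> \<sigma>))"
  let ?X = "\<lambda>K j. mallows_mean (K * m + j) q (\<lambda>\<sigma>. of_bool (no_block m K \<pi> \<sigma> \<and> top_block (K * m) j \<sigma> \<pi>))"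
  have inv: "?N n K = ?N (K * m) K" if "K * m \<le> n" for n K
    by (rule mallows_mean_append_invariant[OF q(1) that]) (simp add: no_block_append_value)
  have c0: "0 < c" "c \<le> 1" using q by (auto simp: c_def power_le_one mult_le_one)
  have step: "c * ?X K j \<le> ?X K (Suc j)" if j: "j < m" for K j
  proof -
    let ?a = "K * m"
    let ?v = "?a + card {i' \<in> {1..Suc j}. \<pi> i' \<le> \<pi> (Suc j)}"
    let ?g = "\<lambda>v. mallows_mean (?a + j) q (\<lambda>\<sigma>. of_bool (no_block m K \<pi> (append_value (?a + j) v \<sigma>) \<and>
        top_block ?a (Suc j) (append_value (?a + j) v \<sigma>) \<pi>))"
    have "card {i' \<in> {1..Suc j}. \<pi> i' \<le> \<pi> (Suc j)} \<le> card {1..Suc j}" by (rule card_mono) auto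
    moreover have "0 < card {i' \<in> {1..Suc j}. \<pi> i' \<le> \<pi> (Suc j)}" by (auto simp: card_gt_0_iff)
    ultimately have v: "?v \<in> {1..Suc (?a + j)}" "Suc (?a + j) - ?v \<le> m" using j by auto
    have w0: "0 \<le> append_weight (?a + j) q v" for v using q q_number_pos[of q "Suc (?a + j)"] by simp
    have g0: "0 \<le> ?g v" for v by (rule mallows_mean_nonneg[OF q(1)]) simp
    have X0: "0 \<le> ?X K j" by (rule mallows_mean_nonneg[OF q(1)]) simp
    have "(1 - q) * q ^ m \<le> append_weight (?a + j) q ?v"
    proof -
      have "q ^ m \<le> q ^ (Suc (?a + j) - ?v)" using v(2) q by (intro power_decreasing) auto
      moreover have "(1 - q) * q_number (Suc (?a + j)) q \<le> 1"
        using q_number_le[OF q, of "Suc (?a + j)"] q by (simp add: field_simps)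
      ultimately have "q ^ m * ((1 - q) * q_number (Suc (?a + j)) q) \<le> q ^ (Suc (?a + j) - ?v) * 1"
        using q q_number_pos[of q "Suc (?a + j)"] by (intro mult_mono) auto
      then show ?thesis using q_number_pos[of q "Suc (?a + j)"] q
        by (simp only: pos_le_divide_eq zero_less_Suc mult_ac mult_1_right)
    qed
    moreover have "?X K j \<le> ?g ?v"
      by (rule mallows_mean_mono[OF q(1)]) (use top_block_append_value[OF \<pi>] in \<open>auto simp: no_block_append_value\<close>)
    ultimately have "c * ?X K j \<le> append_weight (?a + j) q ?v * ?g ?v"
      unfolding c_def by (rule mult_mono[OF _ _ w0 X0])
    also have "\<dots> \<le> (\<Sum>v=1..Suc (?a + j). append_weight (?a + j) q v * ?g v)"
      by (rule member_le_sum[OF v(1)], rule mult_nonneg_nonneg[OF w0 g0], simp)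
    also have "\<dots> = ?X K (Suc j)" unfolding add_Suc_right by (rule mallows_mean_Suc[symmetric])
    finally show ?thesis .
  qed
  have X: "c ^ j * ?N (K * m) K \<le> ?X K j" if "j \<le> m" for K j
    using that
  proof (induction j)
    case 0
    show ?case by (simp add: top_block_def)
  next
    case (Suc j)
    have "c ^ Suc j * ?N (K * m) K = c * (c ^ j * ?N (K * m) K)" by simp
    also have "\<dots> \<le> c * ?X K j" using Suc c0 by (intro mult_left_mono) auto
    also have "\<dots> \<le> ?X K (Suc j)" using step Suc by auto
    finally show ?case .
  qed
  have main: "?N (K * m) K \<le> (1 - c ^ m) ^ K" for K
  proof (induction K)
    case 0
    show ?case using mallows_mean_const[OF q(1), of 0 1] by (simp add: no_block_def)
  next
    case (Suc K)
    let ?n = "K * m + m"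
    have "?N ?n (Suc K) + ?X K m \<le> ?N ?n K"
      unfolding mallows_mean_add[symmetric]
      by (rule mallows_mean_mono[OF q(1)])
        (use top_block_block_pattern in \<open>auto simp: no_block_def less_Suc_eq\<close>)
    moreover have "c ^ m * ?N (K * m) K \<le> ?X K m" by (rule X) simp
    moreover have "?N ?n K = ?N (K * m) K" by (rule inv) simp
    ultimately have "?N ?n (Suc K) \<le> (1 - c ^ m) * ?N (K * m) K" by (simp add: algebra_simps)
    also have "\<dots> \<le> (1 - c ^ m) * (1 - c ^ m) ^ K"
      using Suc c0 by (intro mult_left_mono) (auto simp: power_le_one)
    finally show ?case by (simp add: add.commute)
  qed
  show ?thesis using main[of K] inv[OF assms(4)] unfolding c_def by simp
qed

section \<open>Bounds for a fixed length\<close>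

text \<open>The separator has to be so small that the number of pairs of splits, at most \<open>4 * exp (m / 50)\<close>, is far
  below \<open>2 ^ (m div 5)\<close>.\<close>

definition small_separator :: "nat \<Rightarrow> (nat \<Rightarrow> nat) \<Rightarrow> bool" where
  "small_separator m \<rho> \<longleftrightarrow> separated m (m div 1000) (m div 5) \<rho>"

text \<open>With \<open>\<tau> = m div 4\<close>, one side gets at least \<open>m div 4\<close> and at most about \<open>m / 2\<close> of the block, which leaves
  room for \<open>m div 5\<close> on both sides after the separator is taken out.\<close>

lemma treewidth_ge_of_block:
  assumes "\<sigma> permutes {1..n}" "a + m \<le> n" "\<rho> permutes {1..m}" "block_pattern a m \<sigma> \<rho>"
    and "\<not> small_separator m \<rho>" "100 \<le> m"
  shows "m div 1000 \<le> treewidth (tangled_path n \<sigma>)"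
proof (rule ccontr)
  assume "\<not> m div 1000 \<le> treewidth (tangled_path n \<sigma>)"
  then have "separated m (m div 1000) (m div 5) \<rho>"
    using assms by (intro separated_block_of_treewidth_less[where \<tau> = "m div 4" and a = a]) auto
  then show False using assms by (simp add: small_separator_def)
qed

text \<open>The weight \<open>t = 1 / 1024\<close> in the count of splits makes \<open>(1 + 2 * t) ^ m\<close> at most \<open>exp (m / 512)\<close>, while
  \<open>1 / t ^ (m div 1000)\<close> is at most \<open>2 powr (m / 100)\<close>.\<close>

lemma card_small_separator:
  "real (card {\<rho> \<in> perms m. small_separator m \<rho>}) \<le> 8 * exp (- real m / 12) * fact m"
proof -
  let ?k = "m div 1000" and ?s = "m div 5"
  let ?c = "real (card {\<rho> \<in> perms m. small_separator m \<rho>})"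
  have ln2: "2 / 3 \<le> ln (2::real)" by (rule ln2_ge_two_thirds)
  have "(1 + 2 * (1 / 1024 :: real)) ^ m \<le> exp (1 / 512) ^ m"
    by (rule power_mono) (use exp_ge_add_one_self[of "1 / 512 :: real"] in auto)
  then have 1: "(1 + 2 * (1 / 1024 :: real)) ^ m \<le> exp (real m / 512)" by (simp flip: exp_of_nat_mult)
  have "(1 / 1024 :: real) ^ ?k = exp (- (real ?k * (10 * ln 2)))"
  proof -
    have "(1 / 1024 :: real) = exp (- (10 * ln 2))"
      using exp_of_nat_mult[of 10 "ln 2 :: real"] by (simp add: exp_minus)
    then have "(1 / 1024 :: real) ^ ?k = exp (- (10 * ln 2)) ^ ?k" by (simp only:)
    also have "\<dots> = exp (- (real ?k * (10 * ln 2)))" by (simp only: exp_of_nat_mult[symmetric] mult_minus_right)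
    finally show ?thesis .
  qed
  then have 2: "1 / (1 / 1024 :: real) ^ ?k = exp (real ?k * (10 * ln 2))"
    by (simp only: exp_minus inverse_eq_divide divide_divide_eq_right mult_1_left div_by_1)
  have "real ?k * (10 * ln 2) \<le> real m / 1000 * (10 * ln 2)"
  proof (rule mult_right_mono)
    have "1000 * ?k \<le> m" by (rule times_div_less_eq_dividend)
    then show "real ?k \<le> real m / 1000" by linarith
  qed (use ln2 in simp)
  then have 3: "1 / (1 / 1024 :: real) ^ ?k \<le> exp (real m / 100 * ln 2)" unfolding 2 by simp
  have "2 * (1 + 2 * (1 / 1024)) ^ m / (1 / 1024 :: real) ^ ?k
      = 2 * ((1 + 2 * (1 / 1024)) ^ m * (1 / (1 / 1024) ^ ?k))" by simp
  also have "\<dots> \<le> 2 * (exp (real m / 512) * exp (real m / 100 * ln 2))"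
    using 1 3 by (intro mult_left_mono mult_mono) auto
  finally have "(2 * (1 + 2 * (1 / 1024)) ^ m / (1 / 1024 :: real) ^ ?k)\<^sup>2
      \<le> (2 * (exp (real m / 512) * exp (real m / 100 * ln 2)))\<^sup>2"
    by (rule power_mono) auto
  also have "\<dots> = 4 * exp (real m / 256 + real m / 50 * ln 2)"
    by (simp add: power_mult_distrib flip: exp_of_nat_mult exp_add)
  finally have 4: "(2 * (1 + 2 * (1 / 1024)) ^ m / (1 / 1024 :: real) ^ ?k)\<^sup>2 \<le> \<dots>" .
  have "?c * 2 ^ ?s \<le> (2 * (1 + 2 * (1 / 1024)) ^ m / (1 / 1024) ^ ?k)\<^sup>2 * fact m"
  proof -
    have "{\<rho> \<in> perms m. small_separator m \<rho>} = {\<rho>. \<rho> permutes {1..m} \<and> separated m ?k ?s \<rho>}"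
      by (simp add: small_separator_def)
    moreover have "real (card {\<rho>. \<rho> permutes {1..m} \<and> separated m ?k ?s \<rho>}) * 2 ^ ?s
        \<le> (2 * (1 + 2 * (1 / 1024)) ^ m / (1 / 1024) ^ ?k)\<^sup>2 * fact m"
      by (rule card_separated) auto
    ultimately show ?thesis by (simp only:)
  qed
  also have "\<dots> \<le> 4 * exp (real m / 256 + real m / 50 * ln 2) * fact m"
    using 4 by (intro mult_right_mono) auto
  finally have "?c * 2 ^ ?s \<le> 4 * exp (real m / 256 + real m / 50 * ln 2) * fact m" .
  moreover have "exp (real m / 5 * ln 2) / 2 \<le> 2 ^ ?s"
  proof -
    have "m \<le> 5 * ?s + 4" using dividend_less_times_div[of 5 m] by linarith
    then have "real m / 5 - 1 \<le> real ?s" by linarith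
    then have "(real m / 5 - 1) * ln 2 \<le> real ?s * ln 2" using ln2 by (intro mult_right_mono) auto
    then have "exp ((real m / 5 - 1) * ln 2) \<le> exp (real ?s * ln 2)" by simp
    also have "\<dots> = 2 ^ ?s" by (simp add: exp_of_nat_mult)
    finally show ?thesis by (simp add: left_diff_distrib exp_diff)
  qed
  ultimately have "?c * (exp (real m / 5 * ln 2) / 2) \<le> 4 * exp (real m / 256 + real m / 50 * ln 2) * fact m"
    by (meson mult_left_mono of_nat_0_le_iff order_trans)
  then have "?c \<le> 8 * (exp (real m / 256 + real m / 50 * ln 2) / exp (real m / 5 * ln 2)) * fact m"
    by (simp add: field_simps)
  also have "exp (real m / 256 + real m / 50 * ln 2) / exp (real m / 5 * ln 2)
      = exp (real m / 256 - real m * (9 / 50 * ln 2))"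
    by (simp flip: exp_diff)
  also have "\<dots> \<le> exp (- real m / 12)"
  proof -
    have "real m * (1 / 12 + 1 / 256) \<le> real m * (9 / 50 * ln 2)"
      using ln2 by (intro mult_left_mono) auto
    then show ?thesis by (simp add: algebra_simps)
  qed
  finally show ?thesis by simp
qed

lemma ex_no_small_separator:
  assumes "100 \<le> m"
  obtains \<pi> where "\<pi> permutes {1..m}" "\<not> small_separator m \<pi>"
proof -
  have "(8::real) < exp (100 / 12)"
    using exp_ge_one_plus_x_over_n_power_n[of 2 "100 / 12 :: real"] by (simp add: power2_eq_square)
  also have "\<dots> \<le> exp (real m / 12)" using assms by simp
  finally have "8 * exp (- real m / 12) < 1" by (simp add: exp_minus field_simps)
  then have "8 * exp (- real m / 12) * fact m < 1 * fact m" by (intro mult_strict_right_mono) auto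
  then have "real (card {\<rho> \<in> perms m. small_separator m \<rho>}) < fact m"
    using card_small_separator[of m] by linarith
  moreover have "card (perms m) = fact m" by (rule card_permutations) auto
  ultimately have "{\<rho> \<in> perms m. small_separator m \<rho>} \<noteq> perms m" by (metis less_irrefl of_nat_fact)
  then show ?thesis using that by blast
qed

lemma one_minus_le_ln_inverse:
  fixes q :: real
  assumes "0 < q" shows "1 - q \<le> ln (1 / q)"
  using ln_le_minus_one[OF assms] assms by (simp add: ln_div)

text \<open>As \<open>ln q\<close> is at least \<open>- 2 * (1 - q)\<close>, the factor \<open>q ^ (m * m)\<close> lost against the uniform measure is at
  least \<open>exp (- m / 20)\<close>, and \<open>1 / 12 - 1 / 20 = 1 / 30\<close>.\<close>

lemma mallows_treewidth_first_block:
  assumes q: "1 / 2 \<le> q" "q \<le> 1" and m: "m \<le> n" "100 \<le> m" "40 * (1 - q) * real m \<le> 1"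
  shows "mallows_mean n q (\<lambda>\<sigma>. of_bool (treewidth (tangled_path n \<sigma>) < m div 1000)) \<le> 8 * exp (- real m / 30)"
proof -
  let ?R = "{\<rho> \<in> perms m. small_separator m \<rho>}"
  have q0: "0 < q" using q by simp
  have "mallows_mean n q (\<lambda>\<sigma>. of_bool (treewidth (tangled_path n \<sigma>) < m div 1000))
      \<le> mallows_mean n q (\<lambda>\<sigma>. of_bool (\<not> (\<exists>\<rho>\<in>perms m - ?R. block_pattern 0 m \<sigma> \<rho>)))"
  proof (rule mallows_mean_mono[OF q0])
    fix \<sigma> assume "\<sigma> permutes {1..n}"
    then have "m div 1000 \<le> treewidth (tangled_path n \<sigma>)"
      if "\<rho> \<in> perms m - ?R" "block_pattern 0 m \<sigma> \<rho>" for \<rho>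
      using treewidth_ge_of_block[of \<sigma> n 0 m \<rho>] m that by auto
    then have "\<not> (\<exists>\<rho>\<in>perms m - ?R. block_pattern 0 m \<sigma> \<rho>)" if "treewidth (tangled_path n \<sigma>) < m div 1000"
      using that by (meson not_le)
    then show "(of_bool (treewidth (tangled_path n \<sigma>) < m div 1000) :: real)
        \<le> of_bool (\<not> (\<exists>\<rho>\<in>perms m - ?R. block_pattern 0 m \<sigma> \<rho>))" by simp
  qed
  also have "\<dots> \<le> card ?R / (fact m * q ^ (m * m))"
    by (rule mallows_first_block) (use q q0 m in auto)
  also have "\<dots> \<le> 8 * exp (- real m / 12) / q ^ (m * m)"
    using card_small_separator[of m] q0 by (simp add: field_simps)
  also have "\<dots> \<le> 8 * exp (- real m / 12) / exp (- real m / 20)"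
  proof (intro divide_left_mono)
    have "ln (1 / q) \<le> 1 / q - 1" using q0 by (intro ln_le_minus_one) auto
    also have "\<dots> = (1 - q) / q" using q0 by (simp add: field_simps)
    also have "\<dots> \<le> (1 - q) / (1 / 2)" using q by (intro divide_left_mono) auto
    finally have "- (2 * (1 - q)) \<le> ln q" using q0 by (simp add: ln_div)
    then have "real (m * m) * - (2 * (1 - q)) \<le> real (m * m) * ln q" by (rule mult_left_mono) simp
    moreover have "real m * (40 * (1 - q) * real m) \<le> real m * 1" using m by (intro mult_left_mono) auto
    ultimately have "- real m / 20 \<le> real (m * m) * ln q" by (simp add: algebra_simps)
    then have "exp (- real m / 20) \<le> exp (real (m * m) * ln q)" by simp
    also have "\<dots> = q ^ (m * m)" using q0 by (simp add: exp_of_nat_mult del: of_nat_mult)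
    finally show "exp (- real m / 20) \<le> q ^ (m * m)" .
  qed (use q0 in auto)
  also have "\<dots> = 8 * exp (- real m / 12 - (- real m / 20))"
    by (simp only: exp_diff times_divide_eq_right)
  also have "- real m / 12 - (- real m / 20) = - real m / 30" by (simp add: field_simps)
  finally show ?thesis .
qed

lemma mallows_treewidth_some_block:
  assumes q: "0 < q" "q < 1" and m: "100 \<le> m" "m \<le> n"
  shows "mallows_mean n q (\<lambda>\<sigma>. of_bool (treewidth (tangled_path n \<sigma>) < m div 1000))
    \<le> exp (- (((1 - q) * q ^ m) ^ m * (real n / real m - 1)))"
proof -
  obtain \<pi> where \<pi>: "\<pi> permutes {1..m}" "\<not> small_separator m \<pi>" using ex_no_small_separator[OF m(1)] .
  define K where "K = n div m"
  define c where "c = ((1 - q) * q ^ m) ^ m"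
  have c: "0 \<le> c" "c \<le> 1" unfolding c_def using q by (auto simp: power_le_one mult_le_one)
  have Kn: "K * m \<le> n" by (simp add: K_def)
  have "mallows_mean n q (\<lambda>\<sigma>. of_bool (treewidth (tangled_path n \<sigma>) < m div 1000))
      \<le> mallows_mean n q (\<lambda>\<sigma>. of_bool (no_block m K \<pi> \<sigma>))"
  proof (rule mallows_mean_mono[OF q(1)])
    fix \<sigma> assume \<sigma>: "\<sigma> permutes {1..n}"
    have "m div 1000 \<le> treewidth (tangled_path n \<sigma>)" if nb: "\<not> no_block m K \<pi> \<sigma>"
    proof -
      obtain k where k: "k < K" "block_pattern (k * m) m \<sigma> \<pi>" using nb unfolding no_block_def by blast
      have "Suc k * m \<le> K * m" using k(1) by (intro mult_le_mono1) simp
      then have "k * m + m \<le> n" using Kn by simp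
      then show ?thesis using treewidth_ge_of_block[OF \<sigma> _ \<pi>(1) k(2) \<pi>(2) m(1)] by simp
    qed
    then show "(of_bool (treewidth (tangled_path n \<sigma>) < m div 1000) :: real) \<le> of_bool (no_block m K \<pi> \<sigma>)"
      by (cases "no_block m K \<pi> \<sigma>") auto
  qed
  also have "\<dots> \<le> (1 - c) ^ K" unfolding c_def by (rule mallows_no_block[OF q \<pi>(1) Kn])
  also have "\<dots> \<le> exp (- c) ^ K"
    using exp_ge_add_one_self[of "- c"] c by (intro power_mono) auto
  also have "\<dots> = exp (- (c * real K))" by (simp add: exp_of_nat_mult[symmetric] mult.commute)
  also have "\<dots> \<le> exp (- (c * (real n / real m - 1)))"
  proof -
    have "real n / real m - 1 \<le> real K" 
    proof -
      have "n < m * Suc K" using dividend_less_times_div[of m n] m by (simp add: K_def)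
      then have "real n < real m * (real K + 1)" by (metis of_nat_Suc of_nat_less_iff of_nat_mult add.commute)
      then have "real n / real m < real K + 1" using m by (simp add: pos_divide_less_eq mult.commute)
      then show ?thesis by linarith
    qed
    then show ?thesis using c by (simp add: mult_left_mono)
  qed
  finally show ?thesis unfolding c_def .
qed

lemma mallows_cutwidth_tail:
  assumes q: "0 < q" "q < 1"
  shows "mallows_mean n q (\<lambda>\<sigma>. of_bool (4 * D + 2 < cutwidth (tangled_path n \<sigma>)))
    \<le> (real n + 1) * (q ^ (Suc D * D) * exp (4 / (1 - q)))"
proof -
  have "mallows_mean n q (\<lambda>\<sigma>. of_bool (4 * D + 2 < cutwidth (tangled_path n \<sigma>)))
      \<le> mallows_mean n q (\<lambda>\<sigma>. \<Sum>x\<in>{..n}. of_bool (Suc D \<le> late_low n x x \<sigma>))"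
  proof (rule mallows_mean_mono[OF q(1)])
    fix \<sigma> assume \<sigma>: "\<sigma> permutes {1..n}"
    show "(of_bool (4 * D + 2 < cutwidth (tangled_path n \<sigma>)) :: real)
        \<le> (\<Sum>x\<in>{..n}. of_bool (Suc D \<le> late_low n x x \<sigma>))"
    proof (cases "4 * D + 2 < cutwidth (tangled_path n \<sigma>)")
      case True
      then obtain x where x: "x \<le> n" "Suc D \<le> late_low n x x \<sigma>"
        using cutwidth_tangled_path_le[OF \<sigma>, of D] by (meson not_less not_less_eq_eq)
      have "(of_bool (Suc D \<le> late_low n x x \<sigma>) :: real) \<le> (\<Sum>x\<in>{..n}. of_bool (Suc D \<le> late_low n x x \<sigma>))"
        by (rule member_le_sum[of x]) (use x in auto)
      then show ?thesis using True x by simp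
    qed (simp add: sum_nonneg)
  qed
  also have "\<dots> = (\<Sum>x\<in>{..n}. mallows_mean n q (\<lambda>\<sigma>. of_bool (Suc D \<le> late_low n x x \<sigma>)))"
    by (rule mallows_mean_sum)
  also have "\<dots> \<le> (\<Sum>x\<in>{..n}. q ^ (Suc D * (Suc D - 1)) * exp (4 / (1 - q)))"
    by (intro sum_mono mallows_late_low_tail q) auto
  finally show ?thesis by (simp add: add.commute)
qed

section \<open>High probability\<close>

lemma whp_mallowsI:
  assumes "eventually (\<lambda>n. 0 < q n \<and> mallows_mean n (q n) (\<lambda>\<sigma>. of_bool (\<not> E n \<sigma>)) \<le> \<epsilon> n) sequentially"
    and "\<epsilon> \<longlonglongrightarrow> 0"
  shows "whp (\<lambda>n. mallows n (q n)) E"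
  unfolding whp_def
proof (rule tendsto_sandwich)
  have *: "\<P>(\<sigma> in mallows n (q n). E n \<sigma>) = 1 - mallows_mean n (q n) (\<lambda>\<sigma>. of_bool (\<not> E n \<sigma>))"
    if "0 < q n" for n
  proof -
    have "mallows_mean n (q n) (\<lambda>\<sigma>. of_bool (E n \<sigma>)) + mallows_mean n (q n) (\<lambda>\<sigma>. of_bool (\<not> E n \<sigma>))
        = mallows_mean n (q n) (\<lambda>\<sigma>. 1)"
      unfolding mallows_mean_add[symmetric] by (rule mallows_mean_cong) auto
    then show ?thesis using mallows_prob[OF that] mallows_mean_const[OF that] by simp
  qed
  show "eventually (\<lambda>n. 1 - \<epsilon> n \<le> \<P>(\<sigma> in mallows n (q n). E n \<sigma>)) sequentially"
    using assms(1) by eventually_elim (simp add: *)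
  show "eventually (\<lambda>n. \<P>(\<sigma> in mallows n (q n). E n \<sigma>) \<le> 1) sequentially"
    using assms(1)
  proof eventually_elim
    case (elim n)
    then have "0 \<le> mallows_mean n (q n) (\<lambda>\<sigma>. of_bool (\<not> E n \<sigma>))" by (intro mallows_mean_nonneg) auto
    then show ?case using elim by (simp add: *)
  qed
  show "(\<lambda>n. 1 - \<epsilon> n) \<longlonglongrightarrow> 1" using tendsto_diff[OF tendsto_const assms(2), of 1] by simp
qed simp

lemma mallows_mean_sandwich:
  assumes "0 < q" "1 \<le> n"
    and low: "\<And>\<sigma>. \<sigma> permutes {1..n} \<Longrightarrow> \<not> L \<le> real (treewidth (tangled_path n \<sigma>)) \<Longrightarrow> P \<sigma>"
    and up: "\<And>\<sigma>. \<sigma> permutes {1..n} \<Longrightarrow> \<not> real (cutwidth (tangled_path n \<sigma>)) \<le> U \<Longrightarrow> Q \<sigma>"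
    and "mallows_mean n q (\<lambda>\<sigma>. of_bool (P \<sigma>)) \<le> \<epsilon>" "mallows_mean n q (\<lambda>\<sigma>. of_bool (Q \<sigma>)) \<le> \<delta>"
  shows "mallows_mean n q (\<lambda>\<sigma>. of_bool (\<not> (L \<le> real (treewidth (tangled_path n \<sigma>)) \<and>
      treewidth (tangled_path n \<sigma>) \<le> cutwidth (tangled_path n \<sigma>) \<and>
      real (cutwidth (tangled_path n \<sigma>)) \<le> U))) \<le> \<epsilon> + \<delta>"
proof -
  have "mallows_mean n q (\<lambda>\<sigma>. of_bool (\<not> (L \<le> real (treewidth (tangled_path n \<sigma>)) \<and>
      treewidth (tangled_path n \<sigma>) \<le> cutwidth (tangled_path n \<sigma>) \<and>
      real (cutwidth (tangled_path n \<sigma>)) \<le> U))) \<le> mallows_mean n q (\<lambda>\<sigma>. of_bool (P \<sigma>) + of_bool (Q \<sigma>))"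
  proof (rule mallows_mean_mono[OF assms(1)])
    fix \<sigma> assume \<sigma>: "\<sigma> permutes {1..n}"
    have "treewidth (tangled_path n \<sigma>) \<le> cutwidth (tangled_path n \<sigma>)"
      by (rule treewidth_le_cutwidth[OF simple_graph_tangled_path[OF \<sigma>]]) (use assms(2) in \<open>simp add: tangled_path_def\<close>)
    then show "(of_bool (\<not> (L \<le> real (treewidth (tangled_path n \<sigma>)) \<and>
      treewidth (tangled_path n \<sigma>) \<le> cutwidth (tangled_path n \<sigma>) \<and>
      real (cutwidth (tangled_path n \<sigma>)) \<le> U)) :: real) \<le> of_bool (P \<sigma>) + of_bool (Q \<sigma>)"
      using low[OF \<sigma>] up[OF \<sigma>] by auto
  qed
  then show ?thesis using assms(5,6) by (simp add: mallows_mean_add)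
qed

section \<open>Small parameters\<close>

text \<open>The number \<open>b\<close> is chosen so small that the pattern probability \<open>((1 - q) * q ^ m) ^ m\<close> is at least
  \<open>n powr (- 1 / 2)\<close>: the powers of \<open>q\<close> cost \<open>b\<^sup>2 * l \<le> l / 4\<close> in the exponent, and those of \<open>1 - q\<close>
  cost at most \<open>m * w \<le> l / 4\<close>, because \<open>1 - q\<close> is at least \<open>1 / l\<close>. If the block would be shorter than
  1000, then \<open>X\<close> is bounded and treewidth 1 is enough.\<close>

lemma mallows_small_parameter:
  fixes n :: nat and q \<kappa> b :: real
  defines "l \<equiv> ln (real n)"
  defines "w \<equiv> ln l"
  defines "X \<equiv> sqrt (l / ln (1 / q))"
  assumes n: "2 \<le> n" and w: "1 \<le> w" "4 \<le> \<kappa> * w\<^sup>2" and q: "0 < q" "q \<le> 1 - \<kappa> * (w\<^sup>2 / l)"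
    and \<kappa>: "0 < \<kappa>" and b: "0 < b" "b \<le> 1 / 2" "16 * b\<^sup>2 \<le> \<kappa>"
  shows "mallows_mean n q (\<lambda>\<sigma>. of_bool (\<not> (1 / (2000 * (2 / b + 1)) * (X + 1) \<le> real (treewidth (tangled_path n \<sigma>)) \<and>
      treewidth (tangled_path n \<sigma>) \<le> cutwidth (tangled_path n \<sigma>) \<and>
      real (cutwidth (tangled_path n \<sigma>)) \<le> 8 * (X + 1))))
    \<le> exp (- (real n powr (- 1 / 2) * (real n / l - 1))) + (real n + 1) * real n powr (- 3)"
proof -
  have l0: "0 < l" using w unfolding w_def using n by (simp add: l_def)
  have ln: "l \<le> real n" using ln_le_minus_one[of "real n"] n by (simp add: l_def)
  have gap0: "0 < \<kappa> * (w\<^sup>2 / l)" using \<kappa> w l0 by simp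
  then have q1: "q < 1" using q by simp
  define p where "p = 1 - q"
  define y where "y = ln (1 / q)"
  have p: "0 < p" "\<kappa> * (w\<^sup>2 / l) \<le> p" using q1 q by (auto simp: p_def)
  have yp: "p \<le> y" unfolding p_def y_def by (rule one_minus_le_ln_inverse[OF q(1)])
  then have y0: "0 < y" using p by simp
  have qy: "q ^ k = exp (- (real k * y))" for k
    using q(1) by (simp add: y_def ln_div exp_of_nat_mult)
  have X0: "0 \<le> X" using l0 y0 by (simp add: X_def y_def[symmetric])
  have X2: "X\<^sup>2 * y = l" using l0 y0 by (simp add: X_def y_def[symmetric])
  define m where "m = nat \<lfloor>b * X\<rfloor>"
  have m: "real m \<le> b * X" "b * X < real m + 1" using X0 b by (auto simp: m_def)
  have bXw: "b * X * w \<le> l / 4"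
  proof (rule power2_le_imp_le)
    have "p * X\<^sup>2 \<le> l" using yp X2 mult_right_mono[OF yp, of "X\<^sup>2"] by (simp add: mult.commute)
    moreover have "\<kappa> * (w\<^sup>2 / l) * X\<^sup>2 \<le> p * X\<^sup>2" using p by (intro mult_right_mono) auto
    ultimately have "\<kappa> * w\<^sup>2 * X\<^sup>2 / l \<le> l" by simp
    then have "\<kappa> * w\<^sup>2 * X\<^sup>2 \<le> l\<^sup>2" using l0 by (simp add: pos_divide_le_eq power2_eq_square)
    moreover have "16 * b\<^sup>2 * (w\<^sup>2 * X\<^sup>2) \<le> \<kappa> * (w\<^sup>2 * X\<^sup>2)" using b by (intro mult_right_mono) auto
    ultimately have "16 * (b\<^sup>2 * (w\<^sup>2 * X\<^sup>2)) \<le> l\<^sup>2" by (simp add: mult.assoc)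
    then show "(b * X * w)\<^sup>2 \<le> (l / 4)\<^sup>2" by (simp add: power_mult_distrib power_divide mult_ac)
  qed (use l0 in simp)
  have mw: "real m * w \<le> l / 4" 
  proof -
    have "real m * w \<le> b * X * w" using m w by (intro mult_right_mono) auto
    then show ?thesis using bXw by linarith
  qed
  have "real m * 1 \<le> real m * w" using w by (intro mult_left_mono) auto
  then have ml: "real m \<le> l" using mw l0 by simp
  have c: "real n powr (- 1 / 2) \<le> ((1 - q) * q ^ m) ^ m"
  proof -
    have "1 / l \<le> p"
    proof -
      have "1 / l \<le> \<kappa> * w\<^sup>2 / l" using w l0 by (intro divide_right_mono) auto
      then show ?thesis using p by simp
    qed
    then have "ln (1 / l) \<le> ln p" using l0 by (intro ln_mono) auto
    then have "- w \<le> ln p" using l0 by (simp add: ln_div w_def)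
    then have 1: "real m * - w \<le> real m * ln p" by (intro mult_left_mono) auto
    have "real m * real m \<le> (b * X) * (b * X)" using m X0 b by (intro mult_mono) auto
    then have "real m * real m * y \<le> b * b * (X\<^sup>2 * y)"
      using y0 mult_right_mono[of "real m * real m" "(b * X) * (b * X)" y] by (simp add: power2_eq_square mult_ac)
    also have "\<dots> \<le> 1 / 2 * (1 / 2) * (X\<^sup>2 * y)" using b y0 by (intro mult_right_mono mult_mono) auto
    finally have 2: "real m * real m * y \<le> l / 4" unfolding X2 by simp
    have "real n powr (- 1 / 2) = exp (- (l / 2))" using n by (simp add: powr_def l_def)
    also have "\<dots> \<le> exp (real m * (ln p + - (real m * y)))"
      using 1 2 mw by (simp add: algebra_simps)
    also have "\<dots> = ((1 - q) * q ^ m) ^ m"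
      using p(1) unfolding qy p_def[symmetric] by (simp only: exp_of_nat_mult exp_add exp_ln)
    finally show ?thesis .
  qed
  \<comment> \<open>Now \<open>q ^ (D * D)\<close> is at most the fourth power of \<open>1 / n\<close>; the union bound and the Euler product
    each cost one factor \<open>n\<close>.\<close>
  define D where "D = nat \<lceil>2 * X\<rceil>"
  have D: "2 * X \<le> real D" "real D \<le> 2 * X + 1" 
    using X0 of_nat_ceiling[of "2 * X"] of_int_ceiling_le_add_one[of "2 * X"] by (simp_all add: D_def)
  show ?thesis
  proof (rule mallows_mean_sandwich[where
        P = "\<lambda>\<sigma>. 1000 \<le> m \<and> treewidth (tangled_path n \<sigma>) < m div 1000" and
        Q = "\<lambda>\<sigma>. 4 * D + 2 < cutwidth (tangled_path n \<sigma>)"])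
    show "0 < q" "1 \<le> n" using q n by auto
    have cpos: "0 < 2000 * (2 / b + 1)" using b by (simp add: add_pos_pos)
    show "1000 \<le> m \<and> treewidth (tangled_path n \<sigma>) < m div 1000"
      if \<sigma>: "\<sigma> permutes {1..n}" and less: "\<not> 1 / (2000 * (2 / b + 1)) * (X + 1) \<le> real (treewidth (tangled_path n \<sigma>))" for \<sigma>
    proof (rule ccontr)
      let ?t = "real (treewidth (tangled_path n \<sigma>))"
      assume not: "\<not> (1000 \<le> m \<and> treewidth (tangled_path n \<sigma>) < m div 1000)"
      have t1: "1 \<le> ?t" using treewidth_tangled_path_ge_1[OF \<sigma> n] by simp
      have "real m + 1 \<le> 2000 * ?t"
      proof (cases "1000 \<le> m")
        case True
        have "0 < m div 1000" using True by (simp add: div_greater_zero_iff)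
        then have "m + 1 \<le> 2000 * (m div 1000)" using dividend_less_times_div[of 1000 m] by linarith
        moreover have "m div 1000 \<le> treewidth (tangled_path n \<sigma>)" using True not by simp
        ultimately have "m + 1 \<le> 2000 * treewidth (tangled_path n \<sigma>)" by linarith
        then show ?thesis by linarith
      qed (use t1 in linarith)
      then have "X \<le> 2000 * ?t / b" using m b by (simp add: pos_le_divide_eq mult.commute)
      then have "X + 1 \<le> 2000 * (2 / b + 1) * ?t"
      proof -
        have "2000 * (2 / b + 1) * ?t = 2 * (2000 * ?t / b) + 2000 * ?t" by (simp add: algebra_simps)
        moreover have "0 \<le> 2000 * ?t / b" using b by simp
        ultimately show ?thesis using \<open>X \<le> 2000 * ?t / b\<close> t1 by linarith
      qed
      then show False using less cpos by (simp add: pos_divide_le_eq mult.commute)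
    qed
    show "4 * D + 2 < cutwidth (tangled_path n \<sigma>)"
      if "\<not> real (cutwidth (tangled_path n \<sigma>)) \<le> 8 * (X + 1)" for \<sigma>
    proof -
      have "real (4 * D + 2) \<le> 8 * (X + 1)" using D by simp
      then have "real (4 * D + 2) < real (cutwidth (tangled_path n \<sigma>))" using that by linarith
      then show ?thesis by (simp only: of_nat_less_iff)
    qed
    show "mallows_mean n q (\<lambda>\<sigma>. of_bool (1000 \<le> m \<and> treewidth (tangled_path n \<sigma>) < m div 1000))
        \<le> exp (- (real n powr (- 1 / 2) * (real n / l - 1)))"
    proof (cases "1000 \<le> m")
      case False
      then show ?thesis using mallows_mean_const[OF q(1), of n 0] by simp
    next
      case True
      have "m \<le> n" using ml ln by simp
      then have "mallows_mean n q (\<lambda>\<sigma>. of_bool (treewidth (tangled_path n \<sigma>) < m div 1000))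
          \<le> exp (- (((1 - q) * q ^ m) ^ m * (real n / real m - 1)))"
        using True by (intro mallows_treewidth_some_block q(1) q1) auto
      also have "\<dots> \<le> exp (- (real n powr (- 1 / 2) * (real n / l - 1)))"
      proof -
        have "real n / l \<le> real n / real m" using ml True l0 by (intro divide_left_mono) auto
        moreover have "1 \<le> real n / l" using ln l0 by simp
        ultimately have "real n powr (- 1 / 2) * (real n / l - 1) \<le> ((1 - q) * q ^ m) ^ m * (real n / real m - 1)"
          using c q1 q(1) by (intro mult_mono) auto
        then show ?thesis by simp
      qed
      finally show ?thesis using True by simp
    qed
    have "mallows_mean n q (\<lambda>\<sigma>. of_bool (4 * D + 2 < cutwidth (tangled_path n \<sigma>)))
        \<le> (real n + 1) * (q ^ (Suc D * D) * exp (4 / (1 - q)))"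
      by (rule mallows_cutwidth_tail[OF q(1) q1])
    also have "\<dots> \<le> (real n + 1) * (exp (- (4 * l)) * exp l)"
    proof (intro mult_left_mono mult_mono)
      have "(2 * X)\<^sup>2 \<le> (real D)\<^sup>2" using D X0 by (intro power_mono) auto
      then have "(2 * X)\<^sup>2 * y \<le> (real D)\<^sup>2 * y" using y0 by (intro mult_right_mono) auto
      then have "4 * l \<le> real (D * D) * y" using X2 by (simp add: power2_eq_square mult_ac)
      also have "\<dots> \<le> real (Suc D * D) * y" using y0 by (intro mult_right_mono) auto
      finally show "q ^ (Suc D * D) \<le> exp (- (4 * l))" unfolding qy by simp
      have "4 / (1 - q) \<le> 4 / (\<kappa> * (w\<^sup>2 / l))" unfolding p_def[symmetric]
        by (rule divide_left_mono[OF p(2) _ mult_pos_pos[OF p(1) gap0]]) simp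
      also have "\<dots> = 4 / (\<kappa> * w\<^sup>2) * l" using l0 by simp
      also have "\<dots> \<le> 1 * l" using w l0 by (intro mult_right_mono) auto
      finally show "exp (4 / (1 - q)) \<le> exp l" by simp
    qed auto
    also have "exp (- (4 * l)) * exp l = exp (- 3 * l)" by (simp flip: exp_add)
    also have "exp (- 3 * l) = real n powr (- 3)" using n by (simp add: powr_def l_def)
    finally show "mallows_mean n q (\<lambda>\<sigma>. of_bool (4 * D + 2 < cutwidth (tangled_path n \<sigma>)))
        \<le> (real n + 1) * real n powr (- 3)" .
  qed
qed

section \<open>Parameters near one\<close>

text \<open>The parameter \<open>H\<close> stands for a lower bound on \<open>h = 1 / (1 - q)\<close> that depends on \<open>n\<close> alone. The block length
  is \<open>M / 40\<close>, so the treewidth is about \<open>M / 40000\<close>; for \<open>M\<close> of at least 200000 the gap to \<open>M / 10 ^ 5\<close>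
  absorbs all rounding. A tangled path has at most \<open>2 * n\<close> edges, so the upper bound is immediate
  if \<open>h * ln h\<close> is at least \<open>n\<close>.\<close>

lemma mallows_large_parameter:
  fixes n :: nat and q H :: real
  assumes n: "2 \<le> n" and q: "1 / 2 \<le> q" "q \<le> 1" "(1 - q) * H \<le> 1" and H: "200000 \<le> H" "H \<le> real n"
  shows "mallows_mean n q (\<lambda>\<sigma>. of_bool (\<not> (
        1 / 10 ^ 5 * (if q = 1 then real n else min (1 / (1 - q)) (real n)) \<le> real (treewidth (tangled_path n \<sigma>)) \<and>
        treewidth (tangled_path n \<sigma>) \<le> cutwidth (tangled_path n \<sigma>) \<and>
        real (cutwidth (tangled_path n \<sigma>))
          \<le> 5 * (if q = 1 then real n else min (1 / (1 - q) * ln (1 / (1 - q))) (real n)))))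
    \<le> 8 * exp (- ((H / 40 - 1) / 30)) + (real n + 1) * exp (- (H * (3 / 2 * (ln H)\<^sup>2 - 4)))"
proof -
  have q0: "0 < q" using q by simp
  define M where "M = (if q = 1 then real n else min (1 / (1 - q)) (real n))"
  define h where "h = 1 / (1 - q)"
  have hH: "H \<le> h" if "q \<noteq> 1" using that q by (simp add: h_def pos_le_divide_eq mult.commute)
  have M: "H \<le> M" "M \<le> real n" "(1 - q) * M \<le> 1"
    using hH H q unfolding M_def h_def by (auto simp: min_le_iff_disj mult_le_one) (auto simp: min_def field_simps)
  define m where "m = nat \<lfloor>M / 40\<rfloor>"
  have m: "real m \<le> M / 40" "M / 40 < real m + 1" using M H of_nat_floor[of "M / 40"] by (simp_all add: m_def)
  have lnH: "2 \<le> ln H"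
  proof -
    have "exp (2::real) = exp 1 * exp 1" by (simp flip: exp_add)
    also have "\<dots> \<le> 3 * 3" by (intro mult_mono exp_le) auto
    finally have "exp (2::real) \<le> 200000" by simp
    then have "ln (exp 2) \<le> ln H" using H by (intro ln_mono) auto
    then show ?thesis by simp
  qed
  \<comment> \<open>In these cases the minimum in the upper bound is \<open>n\<close>.\<close>
  define easy where "easy \<longleftrightarrow> q = 1 \<or> real n \<le> h * ln h"
  define L where "L = h * ln h"
  \<comment> \<open>The largest \<open>D\<close> with \<open>4 * D + 2 \<le> 5 * L\<close>. The tail exponent is about \<open>25 / 16\<close> times
    \<open>h * (ln h)\<^sup>2\<close>, of which \<open>3 / 2\<close> is kept; anything above 1 beats the union bound.\<close>
  define D where "D = nat \<lfloor>5 / 4 * L - 1 / 2\<rfloor>"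
  have hard: "2 \<le> ln h" "400000 \<le> L" if "\<not> easy"
  proof -
    have "H \<le> h" using hH that by (auto simp: easy_def)
    then have "ln H \<le> ln h" using H by (intro ln_mono) auto
    then show "2 \<le> ln h" using lnH by simp
    then have "200000 * 2 \<le> h * ln h" using \<open>H \<le> h\<close> H by (intro mult_mono) auto
    then show "400000 \<le> L" by (simp add: L_def)
  qed
  have D: "real D \<le> 5 / 4 * L - 1 / 2" "5 / 4 * L - 1 / 2 < real D + 1" if "\<not> easy"
    using hard(2)[OF that] of_nat_floor[of "5 / 4 * L - 1 / 2"]
    unfolding D_def by linarith+
  show ?thesis unfolding M_def[symmetric]
  proof (rule mallows_mean_sandwich[where
        P = "\<lambda>\<sigma>. treewidth (tangled_path n \<sigma>) < m div 1000" and
        Q = "\<lambda>\<sigma>. \<not> easy \<and> 4 * D + 2 < cutwidth (tangled_path n \<sigma>)"])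
    show "0 < q" "1 \<le> n" using q0 n by auto
    show "treewidth (tangled_path n \<sigma>) < m div 1000"
      if "\<not> 1 / 10 ^ 5 * M \<le> real (treewidth (tangled_path n \<sigma>))" for \<sigma>
    proof -
      have "m < 1000 * (m div 1000) + 1000" using dividend_less_times_div[of 1000 m] by simp
      then have "real m < 1000 * real (m div 1000) + 1000" by linarith
      moreover have "real (treewidth (tangled_path n \<sigma>)) < M / 100000" using that by simp
      ultimately have "real (treewidth (tangled_path n \<sigma>)) < real (m div 1000)" using m(2) M(1) H(1) by linarith
      then show ?thesis by simp
    qed
    show "\<not> easy \<and> 4 * D + 2 < cutwidth (tangled_path n \<sigma>)"
      if \<sigma>: "\<sigma> permutes {1..n}" and "\<not> real (cutwidth (tangled_path n \<sigma>))
          \<le> 5 * (if q = 1 then real n else min (1 / (1 - q) * ln (1 / (1 - q))) (real n))" for \<sigma>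
    proof -
      have c: "real (cutwidth (tangled_path n \<sigma>)) \<le> 2 * real n"
        using cutwidth_tangled_path_le_2n[OF \<sigma>] by linarith
      have "\<not> easy"
      proof
        assume easy
        then have "(if q = 1 then real n else min (1 / (1 - q) * ln (1 / (1 - q))) (real n)) = real n"
          unfolding easy_def h_def by (auto simp: min_def)
        then show False using that(2) c by simp
      qed
      moreover have "5 * L < real (cutwidth (tangled_path n \<sigma>))"
        using that(2) \<open>\<not> easy\<close> unfolding easy_def L_def h_def by (auto simp: min_def)
      moreover have "real (4 * D + 2) \<le> 5 * L" using D(1)[OF \<open>\<not> easy\<close>] by simp
      ultimately have "\<not> easy" "real (4 * D + 2) < real (cutwidth (tangled_path n \<sigma>))" by linarith+
      then show ?thesis by (simp only: of_nat_less_iff simp_thms)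
    qed
    have "mallows_mean n q (\<lambda>\<sigma>. of_bool (treewidth (tangled_path n \<sigma>) < m div 1000)) \<le> 8 * exp (- real m / 30)"
    proof (rule mallows_treewidth_first_block[OF q(1,2)])
      show "m \<le> n" "100 \<le> m" using m M H by linarith+
      have "40 * (1 - q) * real m \<le> 40 * (1 - q) * (M / 40)" using m q by (intro mult_left_mono) auto
      also have "\<dots> = (1 - q) * M" by simp
      finally show "40 * (1 - q) * real m \<le> 1" using M(3) by linarith
    qed
    also have "\<dots> \<le> 8 * exp (- ((H / 40 - 1) / 30))"
    proof -
      have "H / 40 - 1 \<le> real m" using m(2) M(1) by linarith
      then show ?thesis by simp
    qed
    finally show "mallows_mean n q (\<lambda>\<sigma>. of_bool (treewidth (tangled_path n \<sigma>) < m div 1000))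
        \<le> 8 * exp (- ((H / 40 - 1) / 30))" .
    show "mallows_mean n q (\<lambda>\<sigma>. of_bool (\<not> easy \<and> 4 * D + 2 < cutwidth (tangled_path n \<sigma>)))
        \<le> (real n + 1) * exp (- (H * (3 / 2 * (ln H)\<^sup>2 - 4)))"
    proof (cases easy)
      case True
      then show ?thesis using mallows_mean_const[OF q0, of n 0] by simp
    next
      case False
      then have q1: "q < 1" and h: "H \<le> h" using q hH by (auto simp: easy_def)
      note LD = hard[OF False] D[OF False]
      have "mallows_mean n q (\<lambda>\<sigma>. of_bool (4 * D + 2 < cutwidth (tangled_path n \<sigma>)))
          \<le> (real n + 1) * (q ^ (Suc D * D) * exp (4 / (1 - q)))"
        by (rule mallows_cutwidth_tail[OF q0 q1])
      also have "\<dots> \<le> (real n + 1) * (exp (- (3 / 2 * h * (ln h)\<^sup>2)) * exp (4 * h))"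
      proof (intro mult_left_mono mult_mono)
        have "(5 / 4 * L - 1 / 2) * (5 / 4 * L - 3 / 2) \<le> real (Suc D) * real D"
        proof (rule mult_mono)
          have "real (Suc D) = real D + 1" by simp
          then show "5 / 4 * L - 1 / 2 \<le> real (Suc D)" using LD by linarith
          show "5 / 4 * L - 3 / 2 \<le> real D" "0 \<le> 5 / 4 * L - 3 / 2" using LD by linarith+
        qed simp
        moreover have "3 / 2 * L * L \<le> (5 / 4 * L - 1 / 2) * (5 / 4 * L - 3 / 2)"
        proof -
          have "400000 * L \<le> L * L" using LD by (intro mult_right_mono) auto
          moreover have "(5 / 4 * L - 1 / 2) * (5 / 4 * L - 3 / 2) = 25 / 16 * (L * L) - 5 / 2 * L + 3 / 4"
            by (simp add: field_simps)
          moreover have "3 / 2 * L * L = 3 / 2 * (L * L)" by simp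
          ultimately show ?thesis using LD(2) by linarith
        qed
        ultimately have "3 / 2 * L * L \<le> real (Suc D) * real D" by (rule order_trans[rotated])
        then have DD: "3 / 2 * L * L \<le> real (Suc D * D)" by (simp only: of_nat_mult)
        have h0: "0 < h" using h H by simp
        have "real (Suc D * D) * ln q \<le> real (Suc D * D) * - (1 / h)"
          using ln_le_minus_one[OF q0] by (intro mult_left_mono) (auto simp: h_def)
        also have "\<dots> \<le> 3 / 2 * L * L * - (1 / h)" 
          by (rule mult_right_mono_neg[OF DD]) (use h0 in simp)
        also have "\<dots> = - (3 / 2 * h * (ln h)\<^sup>2)" using h0 by (simp add: L_def power2_eq_square)
        finally have "exp (real (Suc D * D) * ln q) \<le> exp (- (3 / 2 * h * (ln h)\<^sup>2))" by simp
        then show "q ^ (Suc D * D) \<le> exp (- (3 / 2 * h * (ln h)\<^sup>2))"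
          using q0 by (simp only: exp_of_nat_mult exp_ln)
      qed (auto simp: h_def)
      also have "\<dots> = (real n + 1) * exp (- (h * (3 / 2 * (ln h)\<^sup>2 - 4)))"
      proof -
        have "exp (- (3 / 2 * h * (ln h)\<^sup>2)) * exp (4 * h) = exp (- (h * (3 / 2 * (ln h)\<^sup>2 - 4)))"
          unfolding exp_add[symmetric] by (simp add: algebra_simps)
        then show ?thesis by (simp only:)
      qed
      also have "\<dots> \<le> (real n + 1) * exp (- (H * (3 / 2 * (ln H)\<^sup>2 - 4)))"
      proof -
        have "ln H \<le> ln h" using H h by (intro ln_mono) auto
        then have "(ln H)\<^sup>2 \<le> (ln h)\<^sup>2" using lnH by (intro power_mono) auto
        moreover have "2\<^sup>2 \<le> (ln H)\<^sup>2" using lnH by (intro power_mono) auto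
        ultimately have "H * (3 / 2 * (ln H)\<^sup>2 - 4) \<le> h * (3 / 2 * (ln h)\<^sup>2 - 4)"
          using H h by (intro mult_mono) auto
        then show ?thesis by (intro mult_left_mono) auto
      qed
      finally show ?thesis using False by simp
    qed
  qed
qed

section \<open>Asymptotics\<close>

lemma eventually_small_parameter_range:
  assumes "\<kappa> > 0"
  shows "eventually (\<lambda>n. 1 \<le> ln (ln (real n)) \<and> 4 \<le> \<kappa> * (ln (ln (real n)))\<^sup>2) sequentially"
proof (intro eventually_conj)
  show "eventually (\<lambda>n. 1 \<le> ln (ln (real n))) sequentially" by real_asymp
  show "eventually (\<lambda>n. 4 \<le> \<kappa> * (ln (ln (real n)))\<^sup>2) sequentially" using assms by real_asymp
qed

lemma small_parameter_error_tendsto_0: "(\<lambda>n. exp (- (real n powr (- 1 / 2) * (real n / ln (real n) - 1))) + (real n + 1) * real n powr (- 3)) \<longlonglongrightarrow> 0"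
  by real_asymp

lemma large_parameter_lower_error_tendsto_0: "(\<lambda>n. 8 * exp (- ((ln (real n) / (ln (ln (real n)))\<^sup>2 / 40 - 1) / 30))) \<longlonglongrightarrow> 0"
  by real_asymp

text \<open>For \<open>H = ln n / (ln (ln n))\<^sup>2\<close> the product \<open>H * (ln H)\<^sup>2\<close> is asymptotic to \<open>ln n\<close>, so the
  exponential is \<open>n powr (- 3 / 2)\<close> up to a subpolynomial factor.\<close>

lemma large_parameter_upper_error_tendsto_0: "(\<lambda>n. (real n + 1) * exp (- (ln (real n) / (ln (ln (real n)))\<^sup>2 * (3 / 2 * (ln (ln (real n) / (ln (ln (real n)))\<^sup>2))\<^sup>2 - 4)))) \<longlonglongrightarrow> 0"
  by real_asymp

lemma eventually_large_parameter_range: "eventually (\<lambda>n. 2 \<le> n \<and> 1 \<le> ln (ln (real n)) \<and> (ln (ln (real n)))\<^sup>2 / ln (real n) \<le> 1 / 2 \<and>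
    ln (real n) / (ln (ln (real n)))\<^sup>2 \<le> real n \<and> 200000 \<le> ln (real n) / (ln (ln (real n)))\<^sup>2) sequentially"
  by (intro eventually_conj; real_asymp)

theorem theorem1p4:
  "(\<forall>\<kappa>::real. \<kappa> > 0 \<longrightarrow> (\<forall>q :: nat \<Rightarrow> real.
      (\<forall>\<^sub>F n in sequentially.
          0 < q n \<and> q n \<le> 1 - \<kappa> * ((ln (ln (real n)))\<^sup>2 / ln (real n))) \<longrightarrow>
      (\<exists>c1 c2 :: real. c1 > 0 \<and> c2 > 0 \<and>
        whp (\<lambda>n. mallows n (q n)) (\<lambda>n \<sigma>.
          c1 * (sqrt (ln (real n) / ln (1 / q n)) + 1) \<le> real (treewidth (tangled_path n \<sigma>)) \<and>
          treewidth (tangled_path n \<sigma>) \<le> cutwidth (tangled_path n \<sigma>) \<and>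
          real (cutwidth (tangled_path n \<sigma>)) \<le> c2 * (sqrt (ln (real n) / ln (1 / q n)) + 1)))))
   \<and>
   (\<forall>q :: nat \<Rightarrow> real.
      (\<forall>\<^sub>F n in sequentially.
          1 - (ln (ln (real n)))\<^sup>2 / ln (real n) \<le> q n \<and> q n \<le> 1) \<longrightarrow>
      whp (\<lambda>n. mallows n (q n)) (\<lambda>n \<sigma>.
          1 / 10 ^ 5 * (if q n = 1 then real n else min (1 / (1 - q n)) (real n))
            \<le> real (treewidth (tangled_path n \<sigma>)) \<and>
          treewidth (tangled_path n \<sigma>) \<le> cutwidth (tangled_path n \<sigma>) \<and>
          real (cutwidth (tangled_path n \<sigma>))
            \<le> 5 * (if q n = 1 then real n
                   else min (1 / (1 - q n) * ln (1 / (1 - q n))) (real n))))"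
proof (intro conjI allI impI)
  fix \<kappa> :: real and q :: "nat \<Rightarrow> real"
  assume \<kappa>: "0 < \<kappa>"
    and q: "\<forall>\<^sub>F n in sequentially. 0 < q n \<and> q n \<le> 1 - \<kappa> * ((ln (ln (real n)))\<^sup>2 / ln (real n))"
  define b where "b = min (1 / 2) (sqrt (\<kappa> / 16))"
  have b: "0 < b" "b \<le> 1 / 2" using \<kappa> by (auto simp: b_def)
  have "b\<^sup>2 \<le> (sqrt (\<kappa> / 16))\<^sup>2" using b(1) by (intro power_mono) (auto simp: b_def)
  then have b2: "16 * b\<^sup>2 \<le> \<kappa>" using \<kappa> by simp
  let ?c1 = "1 / (2000 * (2 / b + 1))"
  have "0 < ?c1" using b by (simp add: add_pos_pos)
  moreover have "whp (\<lambda>n. mallows n (q n)) (\<lambda>n \<sigma>.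
      ?c1 * (sqrt (ln (real n) / ln (1 / q n)) + 1) \<le> real (treewidth (tangled_path n \<sigma>)) \<and>
      treewidth (tangled_path n \<sigma>) \<le> cutwidth (tangled_path n \<sigma>) \<and>
      real (cutwidth (tangled_path n \<sigma>)) \<le> 8 * (sqrt (ln (real n) / ln (1 / q n)) + 1))"
  proof (rule whp_mallowsI[OF _ small_parameter_error_tendsto_0])
    show "\<forall>\<^sub>F n in sequentially. 0 < q n \<and> mallows_mean n (q n) (\<lambda>\<sigma>. of_bool (\<not> (
        ?c1 * (sqrt (ln (real n) / ln (1 / q n)) + 1) \<le> real (treewidth (tangled_path n \<sigma>)) \<and>
        treewidth (tangled_path n \<sigma>) \<le> cutwidth (tangled_path n \<sigma>) \<and>
        real (cutwidth (tangled_path n \<sigma>)) \<le> 8 * (sqrt (ln (real n) / ln (1 / q n)) + 1))))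
        \<le> exp (- (real n powr (- 1 / 2) * (real n / ln (real n) - 1))) + (real n + 1) * real n powr (- 3)"
      using q eventually_small_parameter_range[OF \<kappa>] eventually_ge_at_top[of 2]
    proof eventually_elim
      case (elim n)
      then show ?case using mallows_small_parameter[of n \<kappa> "q n" b] \<kappa> b b2 by blast
    qed
  qed
  ultimately show "\<exists>c1 c2 :: real. c1 > 0 \<and> c2 > 0 \<and>
      whp (\<lambda>n. mallows n (q n)) (\<lambda>n \<sigma>.
        c1 * (sqrt (ln (real n) / ln (1 / q n)) + 1) \<le> real (treewidth (tangled_path n \<sigma>)) \<and>
        treewidth (tangled_path n \<sigma>) \<le> cutwidth (tangled_path n \<sigma>) \<and>
        real (cutwidth (tangled_path n \<sigma>)) \<le> c2 * (sqrt (ln (real n) / ln (1 / q n)) + 1))"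
    by (intro exI[of _ ?c1] exI[of _ 8]) simp
next
  fix q :: "nat \<Rightarrow> real"
  assume q: "\<forall>\<^sub>F n in sequentially. 1 - (ln (ln (real n)))\<^sup>2 / ln (real n) \<le> q n \<and> q n \<le> 1"
  show "whp (\<lambda>n. mallows n (q n)) (\<lambda>n \<sigma>.
          1 / 10 ^ 5 * (if q n = 1 then real n else min (1 / (1 - q n)) (real n))
            \<le> real (treewidth (tangled_path n \<sigma>)) \<and>
          treewidth (tangled_path n \<sigma>) \<le> cutwidth (tangled_path n \<sigma>) \<and>
          real (cutwidth (tangled_path n \<sigma>))
            \<le> 5 * (if q n = 1 then real n
                   else min (1 / (1 - q n) * ln (1 / (1 - q n))) (real n)))"
  proof (rule whp_mallowsI[OF _ tendsto_add_zero[OF large_parameter_lower_error_tendsto_0 large_parameter_upper_error_tendsto_0]])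
    show "\<forall>\<^sub>F n in sequentially. 0 < q n \<and> mallows_mean n (q n) (\<lambda>\<sigma>. of_bool (\<not> (
          1 / 10 ^ 5 * (if q n = 1 then real n else min (1 / (1 - q n)) (real n))
            \<le> real (treewidth (tangled_path n \<sigma>)) \<and>
          treewidth (tangled_path n \<sigma>) \<le> cutwidth (tangled_path n \<sigma>) \<and>
          real (cutwidth (tangled_path n \<sigma>))
            \<le> 5 * (if q n = 1 then real n
                   else min (1 / (1 - q n) * ln (1 / (1 - q n))) (real n)))))
      \<le> 8 * exp (- ((ln (real n) / (ln (ln (real n)))\<^sup>2 / 40 - 1) / 30)) +
        (real n + 1) * exp (- (ln (real n) / (ln (ln (real n)))\<^sup>2 * (3 / 2 * (ln (ln (real n) / (ln (ln (real n)))\<^sup>2))\<^sup>2 - 4)))"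
      using q eventually_large_parameter_range
    proof eventually_elim
      case (elim n)
      define H where "H = ln (real n) / (ln (ln (real n)))\<^sup>2"
      have n: "2 \<le> n" using elim by simp
      have "0 < H" using elim by (simp add: H_def)
      have uH: "(ln (ln (real n)))\<^sup>2 / ln (real n) = 1 / H" by (simp add: H_def)
      have "1 - q n \<le> 1 / H" using elim uH by linarith
      then have 1: "(1 - q n) * H \<le> 1" using \<open>0 < H\<close> by (simp add: pos_le_divide_eq)
      have 2: "1 / 2 \<le> q n" "q n \<le> 1" using elim by linarith+
      have 3: "200000 \<le> H" "H \<le> real n" using elim by (simp_all add: H_def)
      have "0 < q n" using 2 by simp
      then show ?case using mallows_large_parameter[OF n 2 1 3] unfolding H_def by (rule conjI)
    qed
  qed
qed

end
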